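(* There exists a non-finitely generated abelian group $G$ consisting of $C^1$ orientation preserving diffeomorphisms of $\mathbb{R}$ such that there exists an infinite tower $\{(I_j,f_j)\}_{j=1}^\infty$ with $f_j\in G$ for $j=1,2,\dots$ and $\bigcup_{j=1}^\infty I_j=\mathbb{R}$. (Consequently, there exists neither a nonzero $G$-invariant Radon measure on $\mathbb{R}$ nor a nonempty closed minimal set for $G$ in $\mathbb{R}$.)
   Context: For a homeomorphism $g$ of $\mathbb{R}$, $\mathrm{Fix}(g)$ is its set of fixed points. Infinite tower: a sequence of pairs $\{(I_i,f_i)\}_{i=1}^\infty$ where the $I_i=[a_i,b_i]$ ($-\infty<a_i<b_i<+\infty$) are closed intervals with $I_1\subsetneq I_2\subsetneq\cdots$ and the $f_i$ are orientation preserving homeomorphisms of $\mathbb{R}$ with $\mathrm{Fix}(f_i)\cap I_i=\mathrm{End}(I_i)$ for each $i$, where $\mathrm{End}(I_i)=\{a_i,b_i\}$ is the set of endpoints of $I_i$. Radon measure: a Borel measure on $\mathbb{R}$ that is finite on every compact set. It is $G$-invariant if $\mu(g(E))=\mu(E)$ for all $g\in G$ and Borel $E$. A closed minimal set for $G$ is a nonempty $G$-invariant closed subset of $\mathbb{R}$ that is minimal with respect to inclusion among all nonempty $G$-invariant closed subsets. *)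

theory Defs
  imports "HOL-Analysis.Analysis" "HOL-Algebra.Bij" "HOL-Algebra.Generated_Groups"
begin

definition finitely_generated :: "('a, 'b) monoid_scheme \<Rightarrow> bool" where
  "finitely_generated G \<longleftrightarrow>
     (\<exists>S. finite S \<and> S \<subseteq> carrier G \<and> generate G S = carrier G)"

text \<open>On the real line, a homeomorphism preserves orientation iff it is increasing.\<close>

definition orientation_preserving_homeo :: "(real \<Rightarrow> real) \<Rightarrow> bool" where
  "orientation_preserving_homeo f \<longleftrightarrow> (\<exists>g. homeomorphism UNIV UNIV f g) \<and> strict_mono f"

definition orientation_preserving_C1_diffeo :: "(real \<Rightarrow> real) \<Rightarrow> bool" where
  "orientation_preserving_C1_diffeo f \<longleftrightarrow>
     (\<exists>g. homeomorphism UNIV UNIV f g \<and>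
          f C1_differentiable_on UNIV \<and> g C1_differentiable_on UNIV) \<and>
     strict_mono f"

text \<open>
  \<open>BijGroup UNIV\<close> is the group of all bijections of the line under composition
  (every function is extensional on \<open>UNIV\<close>); transformation groups are given by their
  carriers \<open>G\<close>, as subgroups of it.
\<close>

abbreviation transformation_group :: "(real \<Rightarrow> real) set \<Rightarrow> (real \<Rightarrow> real) monoid" where
  "transformation_group G \<equiv> (BijGroup UNIV)\<lparr>carrier := G\<rparr>"

definition Fix :: "(real \<Rightarrow> real) \<Rightarrow> real set" where
  "Fix f = {x. f x = x}"

text \<open>The interval \<open>I\<^sub>i\<close> is \<open>{a i..b i}\<close>; sequences are indexed from \<open>0\<close> instead of \<open>1\<close>.\<close>

definition infinite_tower ::
    "(nat \<Rightarrow> real) \<Rightarrow> (nat \<Rightarrow> real) \<Rightarrow> (nat \<Rightarrow> real \<Rightarrow> real) \<Rightarrow> bool" where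
  "infinite_tower a b f \<longleftrightarrow>
     (\<forall>i. a i < b i) \<and>
     (\<forall>i. {a i..b i} \<subset> {a (Suc i)..b (Suc i)}) \<and>
     (\<forall>i. orientation_preserving_homeo (f i)) \<and>
     (\<forall>i. Fix (f i) \<inter> {a i..b i} = {a i, b i})"

definition radon_measure :: "real measure \<Rightarrow> bool" where
  "radon_measure M \<longleftrightarrow>
     sets M = sets borel \<and> (\<forall>K. compact K \<longrightarrow> emeasure M K < \<infinity>)"

definition invariant_measure :: "(real \<Rightarrow> real) set \<Rightarrow> real measure \<Rightarrow> bool" where
  "invariant_measure G M \<longleftrightarrow> (\<forall>g\<in>G. \<forall>E\<in>sets borel. emeasure M (g ` E) = emeasure M E)"

definition invariant_set :: "(real \<Rightarrow> real) set \<Rightarrow> real set \<Rightarrow> bool" where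
  "invariant_set G A \<longleftrightarrow> (\<forall>g\<in>G. g ` A = A)"

definition closed_minimal_set :: "(real \<Rightarrow> real) set \<Rightarrow> real set \<Rightarrow> bool" where
  "closed_minimal_set G A \<longleftrightarrow>
     A \<noteq> {} \<and> closed A \<and> invariant_set G A \<and>
     (\<forall>B. B \<noteq> {} \<and> closed B \<and> invariant_set G B \<and> B \<subseteq> A \<longrightarrow> B = A)"

end

theory Submission
  imports Defs "HOL-Computational_Algebra.Polynomial"
begin

text \<open>
  The group is \<open>\<int>[x]\<close>, ordered by the sign of the leading coefficient, acting on the line as in
  Denjoy's and Pixton's constructions. To each polynomial \<open>p\<close> we attach a cell of length
  \<open>len p = 1 / (1 + \<Sum>\<^sub>i c\<^sub>i ^ P\<^sub>i)\<close>, where the \<open>c\<^sub>i\<close> are the coefficients and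
  \<open>P\<^sub>i = 2 ^ (i + 2)\<close>, and we lay the cells out in the order of \<open>\<int>[x]\<close>. The lengths are
  summable on polynomials of bounded degree, so any two cells are at finite distance, equal to the
  sum of the lengths in between, whence the cells are dense; the total length is infinite in both
  directions, so they spread over the whole line. The translation by \<open>v\<close> sends the cell of \<open>p\<close> to that of \<open>p + v\<close>
  by Yoccoz's equivariant family of diffeomorphisms between intervals. As
  \<open>len (p + v) / len p \<longrightarrow> 1\<close> in bounded degree, the translations are of class \<open>C\<^sup>1\<close>.

  The interval \<open>I\<^sub>j\<close> is the hull of the cells of degree at most \<open>j\<close>. Translation by \<open>x\<^sup>j\<close>
  pushes every interior point of \<open>I\<^sub>j\<close> to the ends of \<open>I\<^sub>j\<close>, while translation by
  \<open>x ^ (j + 1)\<close> moves \<open>I\<^sub>j\<close> off itself inside \<open>I\<^bsub>j+1\<^esub>\<close>. Hence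
  invariant Radon measures vanish on each \<open>I\<^sub>j\<close>, and a closed invariant set that meets the
  interior of \<open>I\<^sub>j\<close> contains an end of \<open>I\<^sub>j\<close>, whose orbit avoids that interior.
\<close>

section \<open>The ordered group of integer polynomials\<close>

lemma poly_pos_intro:
  fixes p :: "int poly"
  assumes "degree p \<le> k" "0 < coeff p k"
  shows "0 < p"
proof -
  have "degree p = k"
    using assms le_degree[of p k] by auto
  then show ?thesis
    using assms by (simp add: less_poly_def pos_poly_def)
qed

lemma poly_less_intro:
  fixes p q :: "int poly"
  assumes "degree p \<le> k" "degree q \<le> k" "coeff p k < coeff q k"
  shows "p < q"
  using poly_pos_intro[of "q - p" k] degree_diff_le[OF assms(2,1)] assms(3) by simp

text \<open>The least positive element is 1: a positive polynomial is a constant at least 1 or has a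
  positive leading coefficient in higher degree. Hence the cell of \<open>p + 1\<close> directly
  follows the cell of \<open>p\<close>.\<close>

lemma poly_add_one_le:
  fixes p q :: "int poly"
  assumes "p < q"
  shows "p + 1 \<le> q"
proof -
  define r where "r = q - p"
  have lc: "0 < coeff r (degree r)"
    using assms by (simp add: less_poly_def pos_poly_def r_def)
  have "1 \<le> r"
  proof (cases "degree r = 0")
    case True
    then obtain c where c: "r = [:c:]"
      by (rule degree_eq_zeroE)
    show ?thesis
    proof (cases "c = 1")
      case False
      then have "(1::int poly) < r"
        using poly_less_intro[of 1 0 r] lc c by simp
      then show ?thesis by simp
    qed (simp add: c one_pCons)
  next
    case False
    then have "(1::int poly) < r"
      using poly_less_intro[of 1 "degree r" r] lc by (simp add: coeff_eq_0)
    then show ?thesis by simp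
  qed
  then show ?thesis
    by (simp add: r_def algebra_simps)
qed

lemma poly_less_monom_Suc:
  fixes p :: "int poly"
  assumes "degree p \<le> k" "k < m"
  shows "p < monom 1 m"
  using assms by (intro poly_less_intro[of _ m]) (auto simp: degree_monom_le coeff_eq_0)

lemma monom_Suc_less_poly:
  fixes p :: "int poly"
  assumes "degree p \<le> k" "k < m"
  shows "- monom 1 m < p"
  using poly_less_monom_Suc[of "- p" k m] assms by (simp add: minus_less_iff)

text \<open>The coefficient in degree k decides the comparison. This Archimedean property of x ^ k
  among polynomials of degree at most k later drives points to the ends of the k-th
  interval.\<close>

lemma poly_less_monom_multiple:
  fixes p :: "int poly"
  assumes "degree p \<le> k"
  obtains n where "p < of_nat n * monom 1 k"
proof
  let ?n = "nat (\<bar>coeff p k\<bar> + 1)"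
  have "coeff (of_nat ?n * monom (1::int) k) k = \<bar>coeff p k\<bar> + 1"
    by (simp add: of_nat_poly)
  moreover have "degree (of_nat ?n * monom (1::int) k) \<le> k"
    by (simp add: of_nat_poly degree_monom_eq)
  ultimately show "p < of_nat ?n * monom 1 k"
    using assms by (intro poly_less_intro[of _ k]) auto
qed

text \<open>By the sign of its leading coefficient, an \<open>r\<close> of degree above
  \<open>k\<close> would exceed \<open>q\<close> or lie below \<open>p\<close>. Order intervals thus
  have bounded degree, the setting in which lengths are summable.\<close>

lemma degree_le_between:
  fixes p q r :: "int poly"
  assumes "p \<le> r" "r \<le> q" "degree p \<le> k" "degree q \<le> k"
  shows "degree r \<le> k"
proof (rule ccontr)
  assume k: "\<not> degree r \<le> k"
  then have "r \<noteq> 0" by auto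
  then have "coeff r (degree r) \<noteq> 0" by simp
  then consider "coeff r (degree r) > 0" | "coeff r (degree r) < 0" by linarith
  then show False
  proof cases
    case 1
    then have "q < r"
      using k assms by (intro poly_less_intro[of _ "degree r"]) (auto simp: coeff_eq_0)
    then show False using assms by simp
  next
    case 2
    then have "r < p"
      using k assms by (intro poly_less_intro[of _ "degree r"]) (auto simp: coeff_eq_0)
    then show False using assms by simp
  qed
qed

section \<open>Heights and lengths\<close>

text \<open>The exponents are \<open>2 * 2 ^ (i + 1)\<close>: as the sum of \<open>1 / 2 ^ (i + 1)\<close> stays below 1, the height
  dominates the product of the \<open>max 1 c\<^sub>i\<^sup>2\<close> in any number of coefficients, whence the
  summability of \<open>1 / height\<close> in every bounded degree.\<close>

definition height :: "int poly \<Rightarrow> real" where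
  "height p = 1 + (\<Sum>i\<le>degree p. real_of_int (coeff p i) ^ (2 ^ (i + 2)))"

definition len :: "int poly \<Rightarrow> real" where
  "len p = 1 / height p"

lemma height_bounded_degree:
  assumes "degree p \<le> k"
  shows "height p = 1 + (\<Sum>i\<le>k. real_of_int (coeff p i) ^ (2 ^ (i + 2)))"
proof -
  have "(\<Sum>i\<le>k. real_of_int (coeff p i) ^ (2 ^ (i + 2))) =
    (\<Sum>i\<le>degree p. real_of_int (coeff p i) ^ (2 ^ (i + 2)))"
    using assms by (intro sum.mono_neutral_right) (auto simp: coeff_eq_0)
  then show ?thesis by (simp add: height_def)
qed

lemma even_power_nonneg: "0 \<le> (c::real) ^ (2 ^ (i + 2))"
  by (intro zero_le_even_power) simp

lemma height_ge_1: "1 \<le> height p"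
  unfolding height_def by (simp add: sum_nonneg even_power_nonneg del: add_2_eq_Suc')

lemma height_pos: "0 < height p"
  using height_ge_1[of p] by linarith

lemma len_pos: "0 < len p"
  by (simp add: len_def height_pos)

lemma height_ge_coeff:
  "max 1 \<bar>real_of_int (coeff p i)\<bar> ^ (2 ^ (i + 2)) \<le> height p"
proof -
  have "real_of_int (coeff p i) ^ (2 ^ (i + 2)) \<le> (\<Sum>j\<le>max i (degree p). real_of_int (coeff p j) ^ (2 ^ (j + 2)))"
    by (intro member_le_sum[of i "{..max i (degree p)}" "\<lambda>j. real_of_int (coeff p j) ^ (2 ^ (j + 2))"])
      (auto simp: even_power_nonneg simp del: add_2_eq_Suc')
  then have "real_of_int (coeff p i) ^ (2 ^ (i + 2)) \<le> height p"
    using height_bounded_degree[of p "max i (degree p)"] by simp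
  moreover have "\<bar>real_of_int (coeff p i)\<bar> ^ (2 ^ (i + 2)) = real_of_int (coeff p i) ^ (2 ^ (i + 2))"
    by (intro power_even_abs) simp
  ultimately show ?thesis
    using height_ge_1[of p] by (simp add: max_def)
qed

section \<open>Summability of the lengths in bounded degree\<close>

definition coeff_weight :: "int \<Rightarrow> real" where
  "coeff_weight c = 1 / (max 1 \<bar>real_of_int c\<bar>)\<^sup>2"

text \<open>Each factor is at most the (2 ^ (i + 1))-th root of \<open>N\<close>, and 1/2 + 1/4 +
  ... stays below 1 over finitely many terms. Raising to the power 2 ^ k keeps the induction within
  natural exponents.\<close>

lemma prod_le_of_dyadic_powers:
  fixes y :: "nat \<Rightarrow> real"
  assumes "\<And>i. 1 \<le> y i" "\<And>i. y i ^ (2 ^ (i + 1)) \<le> N" 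
  shows "(\<Prod>i<k. y i) \<le> N"
proof -
  have N1: "1 \<le> N"
    using assms(1)[of 0] assms(2)[of 0] one_le_power[of "y 0" "2 ^ (0+1)"] by linarith
  have pr: "0 \<le> (\<Prod>i<k. y i)" for k
    using assms(1) by (intro prod_nonneg) (meson order.trans zero_le_one)
  have "(\<Prod>i<k. y i) ^ (2 ^ k) \<le> N ^ (2 ^ k - 1)" for k
  proof (induction k)
    case (Suc k)
    have "(\<Prod>i<Suc k. y i) ^ (2 ^ Suc k) = ((\<Prod>i<k. y i) ^ (2 ^ k))\<^sup>2 * y k ^ (2 ^ (k + 1))"
      by (simp add: power_mult_distrib mult.commute flip: power_mult)
    also have "\<dots> \<le> (N ^ (2 ^ k - 1))\<^sup>2 * N"
      using Suc assms(2)[of k] pr N1 order.trans[OF zero_le_one assms(1)[of k]]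
      by (intro mult_mono power_mono zero_le_power) auto
    also have "\<dots> = N ^ (2 * (2 ^ k - 1) + 1)"
      by (simp add: power_add mult.commute flip: power_mult)
    also have "2 * (2 ^ k - 1) + 1 = 2 ^ Suc k - (1::nat)"
      using zero_less_power[of "2::nat" k] by (simp only: power_Suc) linarith
    finally show ?case .
  qed simp
  also have "N ^ (2 ^ k - 1) \<le> N ^ (2 ^ k)"
    using N1 by (intro power_increasing) auto
  finally show ?thesis
    using N1 pr by (simp add: power_mono_iff)
qed

lemma len_le_prod_weight:
  "len p \<le> (\<Prod>i<k. coeff_weight (coeff p i))"
proof -
  let ?y = "\<lambda>i. (max 1 \<bar>real_of_int (coeff p i)\<bar>)\<^sup>2"
  have "(\<Prod>i<k. ?y i) \<le> height p"
  proof (rule prod_le_of_dyadic_powers)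
    show "?y i ^ (2 ^ (i + 1)) \<le> height p" for i
      using height_ge_coeff[of p i] by (simp flip: power_mult)
  qed simp
  moreover have "0 < (\<Prod>i<k. ?y i)"
    by (intro prod_pos zero_less_power) (simp add: less_max_iff_disj)
  ultimately have "1 / height p \<le> 1 / (\<Prod>i<k. ?y i)"
    by (intro divide_left_mono mult_pos_pos) (auto simp: height_pos)
  then show ?thesis
    by (simp add: len_def coeff_weight_def prod_dividef)
qed

lemma coeff_weight_pos: "0 < coeff_weight c"
  by (simp add: coeff_weight_def less_max_iff_disj)

lemma summable_coeff_weight: "coeff_weight summable_on UNIV"
proof -
  have *: "(\<lambda>n::nat. coeff_weight (int n)) summable_on UNIV"
  proof (rule norm_summable_imp_summable_on)
    have "summable (\<lambda>n. coeff_weight (int n))"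
    proof (rule summable_comparison_test'[of _ 1])
      show "summable (\<lambda>n::nat. 1 / real n ^ 2)"
        using inverse_power_summable[of 2, where 'a = real] by (simp add: inverse_eq_divide)
      show "norm (coeff_weight (int n)) \<le> 1 / real n ^ 2" if "n \<ge> 1" for n
        using that by (simp add: coeff_weight_def max_def)
    qed
    then show "summable (\<lambda>n. norm (coeff_weight (int n)))"
      using coeff_weight_pos by (simp add: less_imp_le)
  qed
  have 1: "coeff_weight summable_on range int"
    using * by (subst summable_on_reindex) (auto simp: o_def)
  have 2: "coeff_weight summable_on range (\<lambda>n. - int n)"
    using * by (subst summable_on_reindex) (auto simp: o_def inj_def coeff_weight_def)
  have "range int \<union> range (\<lambda>n. - int n) = UNIV"
    by (auto simp: image_iff) (metis int_cases2)
  then show ?thesis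
    using summable_on_union[OF 1 2] by simp
qed

text \<open>The series factorizes into one copy of the series of \<open>coeff_weight\<close> per
  coefficient. Splitting off the constant coefficient by \<open>pCons\<close> turns it into a sum
  over a product.\<close>

lemma summable_prod_weight:
  "(\<lambda>p. \<Prod>i<k. coeff_weight (coeff p i)) summable_on {p. \<forall>i\<ge>k. coeff p i = 0}"
proof (induction k)
  case 0
  have "{p :: int poly. \<forall>i\<ge>0. coeff p i = 0} = {0}"
    by (auto simp: poly_eq_iff)
  then show ?case by simp
next
  case (Suc k)
  define A where "A = {p :: int poly. \<forall>i\<ge>k. coeff p i = 0}"
  define f where "f = (\<lambda>p. \<Prod>i<k. coeff_weight (coeff p i))"
  have eq: "{p :: int poly. \<forall>i\<ge>Suc k. coeff p i = 0} = (\<lambda>(a, p). pCons a p) ` (UNIV \<times> A)"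
  proof (intro Set.set_eqI iffI)
    fix p :: "int poly" assume *: "p \<in> {p. \<forall>i\<ge>Suc k. coeff p i = 0}"
    obtain a q where p: "p = pCons a q" by (cases p)
    have "q \<in> A"
      using * unfolding p A_def by (auto dest: spec[of _ "Suc _"])
    then show "p \<in> (\<lambda>(a, p). pCons a p) ` (UNIV \<times> A)"
      unfolding p by auto
  next
    fix p assume "p \<in> (\<lambda>(a, p). pCons a p) ` (UNIV \<times> A)"
    then show "p \<in> {p. \<forall>i\<ge>Suc k. coeff p i = 0}"
      by (auto simp: A_def coeff_pCons split: nat.splits)
  qed
  have inj: "inj_on (\<lambda>(a, p). pCons a p) ((UNIV :: int set) \<times> A)"
    by (auto simp: inj_on_def)
  have "(\<lambda>(a, p). coeff_weight a * f p) summable_on UNIV \<times> A"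
  proof (rule summable_on_SigmaI)
    show "((\<lambda>p. case (a, p) of (a, p) \<Rightarrow> coeff_weight a * f p) has_sum coeff_weight a * infsum f A) A" for a
      using has_sum_cmult_right[OF has_sum_infsum[OF Suc.IH], of "coeff_weight a"] by (simp add: f_def A_def)
    show "(\<lambda>a. coeff_weight a * infsum f A) summable_on UNIV"
      by (intro summable_on_cmult_left summable_coeff_weight)
    show "0 \<le> (case (a, p) of (a, p) \<Rightarrow> coeff_weight a * f p)" for a p
      by (simp add: f_def coeff_weight_pos less_imp_le prod_nonneg)
  qed
  then show ?case
    unfolding eq
    by (subst summable_on_reindex[OF inj])
      (simp add: o_def case_prod_unfold f_def prod.lessThan_Suc_shift del: prod.lessThan_Suc)
qed

lemma len_summable_degree_le: "len summable_on {p. degree p \<le> k}"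
proof -
  have "{p :: int poly. degree p \<le> k} = {p. \<forall>i\<ge>Suc k. coeff p i = 0}"
    by (auto simp: coeff_eq_0 intro: degree_le)
  moreover have "(\<lambda>p. \<Prod>i<Suc k. coeff_weight (coeff p i)) summable_on {p. \<forall>i\<ge>Suc k. coeff p i = 0}"
    by (rule summable_prod_weight)
  ultimately have "(\<lambda>p. \<Prod>i<Suc k. coeff_weight (coeff p i)) summable_on {p. degree p \<le> k}"
    by simp
  then show ?thesis
    by (rule summable_on_comparison_test) (auto simp only: len_le_prod_weight len_pos intro: less_imp_le)
qed

lemma len_summable_interval: "len summable_on {p..<q}"
proof (rule summable_on_subset)
  show "len summable_on {r. degree r \<le> max (degree p) (degree q)}"
    by (rule len_summable_degree_le)
  show "{p..<q} \<subseteq> {r. degree r \<le> max (degree p) (degree q)}"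
    by (auto intro: degree_le_between[of p _ q])
qed

section \<open>Lengths of translated cells\<close>

lemma power_shift_estimate:
  fixes w :: real
  assumes "0 < \<epsilon>"
  obtains C where "0 \<le> C" "\<And>c. \<bar>(c + w) ^ n - c ^ n\<bar> \<le> \<epsilon> * \<bar>c\<bar> ^ n + C"
proof -
  \<comment> \<open>For |c| > K, the first summand gives
    \<open>\<bar>c + w\<bar> \<le> 2 * \<bar>c\<bar>\<close>, and the second makes the change of the
    power, which is of order |c| ^ (n - 1), at most \<epsilon> * |c| ^ n. For |c| up to K, a
    constant bounds the change.\<close>
  define K where "K = \<bar>w\<bar> + real n * \<bar>w\<bar> * 2 ^ n / \<epsilon>"
  have K: "\<bar>w\<bar> \<le> K" "real n * \<bar>w\<bar> * 2 ^ n / \<epsilon> \<le> K" "0 \<le> K"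
    using assms by (auto simp: K_def)
  define C where "C = (K + \<bar>w\<bar>) ^ n + K ^ n"
  show thesis
  proof
    show C: "0 \<le> C" using K by (simp add: C_def)
    fix c :: real
    show "\<bar>(c + w) ^ n - c ^ n\<bar> \<le> \<epsilon> * \<bar>c\<bar> ^ n + C"
    proof (cases "\<bar>c\<bar> \<le> K")
      case True
      have "\<bar>(c + w) ^ n - c ^ n\<bar> \<le> \<bar>c + w\<bar> ^ n + \<bar>c\<bar> ^ n"
        by (metis abs_triangle_ineq4 power_abs)
      also have "\<dots> \<le> C"
        unfolding C_def using True by (intro add_mono power_mono) auto
      also have "\<dots> \<le> \<epsilon> * \<bar>c\<bar> ^ n + C"
        using assms by simp
      finally show ?thesis .
    next
      case False
      show ?thesis
      proof (cases n)
        case 0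
        then show ?thesis using C assms by simp
      next
        case (Suc m)
        have cw: "\<bar>c + w\<bar> \<le> 2 * \<bar>c\<bar>"
          using K False by linarith
        have "\<bar>\<Sum>i<Suc m. (c + w) ^ i * c ^ (m - i)\<bar> \<le> (\<Sum>i<Suc m. (2 * \<bar>c\<bar>) ^ i * (2 * \<bar>c\<bar>) ^ (m - i))"
        proof (rule order_trans[OF sum_abs], rule sum_mono)
          show "\<bar>(c + w) ^ i * c ^ (m - i)\<bar> \<le> (2 * \<bar>c\<bar>) ^ i * (2 * \<bar>c\<bar>) ^ (m - i)" for i
            unfolding abs_mult power_abs by (intro mult_mono power_mono cw) auto
        qed
        also have "\<dots> = real n * (2 * \<bar>c\<bar>) ^ m"
        proof -
          have "(2 * \<bar>c\<bar>) ^ i * (2 * \<bar>c\<bar>) ^ (m - i) = (2 * \<bar>c\<bar>) ^ m" if "i \<in> {..<Suc m}" for i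
            using that by (simp only: power_add[symmetric]) simp
          then have "(\<Sum>i<Suc m. (2 * \<bar>c\<bar>) ^ i * (2 * \<bar>c\<bar>) ^ (m - i)) = (\<Sum>i<Suc m. (2 * \<bar>c\<bar>) ^ m)"
            by (intro sum.cong) auto
          then show ?thesis by (simp add: Suc del: sum.lessThan_Suc)
        qed
        finally have s: "\<bar>\<Sum>i<Suc m. (c + w) ^ i * c ^ (m - i)\<bar> \<le> real n * (2 * \<bar>c\<bar>) ^ m" .
        have "\<bar>(c + w) ^ n - c ^ n\<bar> = \<bar>w\<bar> * \<bar>\<Sum>i<Suc m. (c + w) ^ i * c ^ (m - i)\<bar>"
          unfolding Suc diff_power_eq_sum by (simp add: abs_mult)
        also have "\<dots> \<le> \<bar>w\<bar> * (real n * (2 * \<bar>c\<bar>) ^ m)"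
          by (intro mult_left_mono s) simp
        also have "\<dots> = (real n * \<bar>w\<bar> * 2 ^ m) * \<bar>c\<bar> ^ m"
          by (simp add: power_mult_distrib)
        also have "\<dots> \<le> (\<epsilon> * \<bar>c\<bar>) * \<bar>c\<bar> ^ m"
        proof (intro mult_right_mono)
          have "real n * \<bar>w\<bar> * 2 ^ m \<le> real n * \<bar>w\<bar> * 2 ^ n"
            using Suc by (intro mult_left_mono power_increasing) auto
          also have "\<dots> \<le> \<epsilon> * K"
            using K(2) assms by (simp add: field_simps)
          also have "\<dots> \<le> \<epsilon> * \<bar>c\<bar>"
            using False assms by simp
          finally show "real n * \<bar>w\<bar> * 2 ^ m \<le> \<epsilon> * \<bar>c\<bar>" .
        qed simp
        also have "\<dots> = \<epsilon> * \<bar>c\<bar> ^ n"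
          by (simp add: Suc)
        finally show ?thesis using C by simp
      qed
    qed
  qed
qed

text \<open>\<open>power_shift_estimate\<close> applies to each coefficient. What matters is that
  \<open>C\<close> does not depend on \<open>p\<close>, so that large heights absorb it.\<close>

lemma height_shift_estimate:
  fixes v :: "int poly"
  assumes "0 < \<epsilon>" "degree v \<le> k"
  obtains C where "\<And>p. degree p \<le> k \<Longrightarrow> \<bar>height (p + v) - height p\<bar> \<le> \<epsilon> * height p + C"
proof -
  have "\<exists>C. \<forall>c. \<bar>(c + real_of_int (coeff v i)) ^ (2 ^ (i + 2)) - c ^ (2 ^ (i + 2))\<bar>
      \<le> \<epsilon> * \<bar>c\<bar> ^ (2 ^ (i + 2)) + C" for i
    by (rule power_shift_estimate[OF assms(1)]) blast
  then obtain C where C: "\<And>i c. \<bar>(c + real_of_int (coeff v i)) ^ (2 ^ (i + 2)) - c ^ (2 ^ (i + 2))\<bar>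
      \<le> \<epsilon> * \<bar>c\<bar> ^ (2 ^ (i + 2)) + C i"
    by metis
  show thesis
  proof
    fix p :: "int poly" assume p: "degree p \<le> k"
    let ?e = "\<lambda>i. 2 ^ (i + 2) :: nat"
    let ?c = "\<lambda>i. real_of_int (coeff p i)"
    let ?w = "\<lambda>i. real_of_int (coeff v i)"
    have pv: "degree (p + v) \<le> k"
      using p assms by (simp add: degree_add_le)
    have "\<bar>height (p + v) - height p\<bar> = \<bar>\<Sum>i\<le>k. (?c i + ?w i) ^ ?e i - ?c i ^ ?e i\<bar>"
      unfolding height_bounded_degree[OF p] height_bounded_degree[OF pv] by (simp add: sum_subtractf)
    also have "\<dots> \<le> (\<Sum>i\<le>k. \<epsilon> * \<bar>?c i\<bar> ^ ?e i + C i)"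
      by (rule order_trans[OF sum_abs]) (intro sum_mono C)
    also have "\<dots> = \<epsilon> * (\<Sum>i\<le>k. ?c i ^ ?e i) + sum C {..k}"
      by (simp add: sum.distrib sum_distrib_left power_even_abs)
    also have "\<dots> \<le> \<epsilon> * height p + sum C {..k}"
      unfolding height_bounded_degree[OF p] using assms by simp
    finally show "\<bar>height (p + v) - height p\<bar> \<le> \<epsilon> * height p + sum C {..k}" .
  qed
qed

lemma finite_len_ge:
  assumes "0 < \<epsilon>"
  shows "finite {p. degree p \<le> k \<and> \<epsilon> \<le> len p}"
proof -
  define B where "B = infsum len {p. degree p \<le> k}"
  have "card F \<le> nat \<lceil>B / \<epsilon>\<rceil>" if "F \<subseteq> {p. degree p \<le> k \<and> \<epsilon> \<le> len p}" "finite F" for F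
  proof -
    have "real (card F) * \<epsilon> \<le> sum len F"
      using that by (intro sum_bounded_below) auto
    also have "\<dots> \<le> B"
      unfolding B_def using that len_pos
      by (intro finite_sum_le_infsum len_summable_degree_le) (auto intro: less_imp_le)
    finally have "real (card F) \<le> B / \<epsilon>"
      using assms by (simp add: field_simps)
    then show ?thesis by linarith
  qed
  then show ?thesis
    by (rule finite_if_finite_subsets_card_bdd[THEN conjunct1])
qed

text \<open>When \<open>len p\<close> is small, \<open>height p\<close> is large enough to absorb
  the constant of \<open>height_shift_estimate\<close>, and the relative change of height is small.
  Only finitely many long cells escape this.\<close>

lemma finite_len_ratio_far:
  assumes "0 < \<epsilon>"
  shows "finite {p. degree p \<le> k \<and> \<epsilon> \<le> \<bar>len (p + v) / len p - 1\<bar>}"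
proof -
  define m where "m = max k (degree v)"
  \<comment> \<open>The bound \<epsilon> / 4 pays for two factors 2: one from absorbing
    \<open>C\<close>, one from replacing \<open>height p\<close> by
    \<open>2 * height (p + v)\<close>. The bound 1 / 4 justifies the latter.\<close>
  define \<delta> where "\<delta> = min (\<epsilon> / 4) (1 / 4)"
  have \<delta>: "0 < \<delta>" "\<delta> \<le> \<epsilon> / 4" "\<delta> \<le> 1 / 4"
    using assms by (auto simp: \<delta>_def)
  obtain C where C: "\<And>p. degree p \<le> m \<Longrightarrow> \<bar>height (p + v) - height p\<bar> \<le> \<delta> * height p + C"
    using height_shift_estimate[of \<delta> v m] \<delta> by (auto simp: m_def)
  have close: "\<bar>len (p + v) / len p - 1\<bar> < \<epsilon>"
    if "degree p \<le> k" "len p < \<delta> / (\<bar>C\<bar> + 1)" for p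
  proof -
    have "\<bar>C\<bar> + 1 < \<delta> * height p"
      using that(2) height_pos[of p] by (simp add: len_def field_simps)
    then have "\<bar>height (p + v) - height p\<bar> < 2 * \<delta> * height p"
      using C[of p] that(1) abs_ge_self[of C] by (simp add: m_def mult.assoc le_max_iff_disj)
    then have *: "\<bar>height p - height (p + v)\<bar> < 2 * \<delta> * height p"
      by linarith
    have "2 * \<delta> * height p \<le> 1 / 2 * height p"
      using \<delta> height_pos[of p] by (intro mult_right_mono) auto
    then have h: "height p < 2 * height (p + v)"
      using * by linarith
    have "2 * \<delta> * height p \<le> 2 * \<delta> * (2 * height (p + v))"
      using h \<delta> by (intro mult_left_mono) auto
    also have "\<dots> \<le> \<epsilon> * height (p + v)"
      using \<delta> mult_right_mono[of "4 * \<delta>" \<epsilon> "height (p + v)"] height_pos[of "p + v"] by simp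
    finally have "\<bar>height p - height (p + v)\<bar> < \<epsilon> * height (p + v)"
      using * by linarith
    then have "\<bar>height p - height (p + v)\<bar> / height (p + v) < \<epsilon>"
      using height_pos[of "p + v"] by (simp add: field_simps)
    moreover have "len (p + v) / len p - 1 = (height p - height (p + v)) / height (p + v)"
      using height_pos[of "p + v"] height_pos[of p] by (simp add: len_def field_simps)
    ultimately show ?thesis
      using height_pos[of "p + v"] by (simp add: abs_divide)
  qed
  have "{p. degree p \<le> k \<and> \<epsilon> \<le> \<bar>len (p + v) / len p - 1\<bar>} \<subseteq> {p. degree p \<le> k \<and> \<delta> / (\<bar>C\<bar> + 1) \<le> len p}"
    using close by force
  then show ?thesis
    using finite_len_ge[of "\<delta> / (\<bar>C\<bar> + 1)" k] \<delta> by (auto intro: finite_subset)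
qed


section \<open>Cells of the line indexed by polynomials\<close>

text \<open>The left end of the cell of \<open>p\<close>. At least one of the two order intervals is
  empty, so this is a signed length measured from the left end of the cell of 0.\<close>

definition pos :: "int poly \<Rightarrow> real" where
  "pos p = infsum len {0..<p} - infsum len {p..<0}"

lemma infsum_len_split:
  assumes "p \<le> q" "q \<le> r"
  shows "infsum len {p..<r} = infsum len {p..<q} + infsum len {q..<r}"
proof -
  have "{p..<r} = {p..<q} \<union> {q..<r}"
    using assms by auto
  then show ?thesis
    by (simp add: infsum_Un_disjoint len_summable_interval ivl_disj_int)
qed

lemma pos_diff:
  assumes "p \<le> q"
  shows "pos q - pos p = infsum len {p..<q}"
proof -
  consider "0 \<le> p" | "p \<le> 0" "0 \<le> q" | "q \<le> 0"
    by linarith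
  then show ?thesis
  proof cases
    case 1
    then show ?thesis
      using infsum_len_split[of 0 p q] assms by (simp add: pos_def)
  next
    case 2
    then show ?thesis
      using infsum_len_split[of p 0 q] by (simp add: pos_def)
  next
    case 3
    then show ?thesis
      using infsum_len_split[of p q 0] assms by (simp add: pos_def)
  qed
qed

lemma pos_0 [simp]: "pos 0 = 0"
  by (simp add: pos_def)

lemma pos_add_one: "pos (p + 1) = pos p + len p"
proof -
  have "{p..<p + 1} = {p}"
    using poly_add_one_le by fastforce
  then show ?thesis
    using pos_diff[of p "p + 1"] by simp
qed

lemma sum_len_le_pos_diff:
  assumes "p \<le> q" "finite F" "F \<subseteq> {p..<q}"
  shows "sum len F \<le> pos q - pos p"
  unfolding pos_diff[OF assms(1)]
  using assms len_pos by (intro finite_sum_le_infsum len_summable_interval) (auto intro: less_imp_le)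

lemma strict_mono_pos: "strict_mono pos"
proof (rule strict_monoI)
  fix p q :: "int poly" assume "p < q"
  then have "sum len {p} \<le> pos q - pos p"
    by (intro sum_len_le_pos_diff) auto
  then show "pos p < pos q"
    using len_pos[of p] by simp
qed

lemma pos_less_iff [simp]: "pos p < pos q \<longleftrightarrow> p < q"
  by (rule strict_mono_less[OF strict_mono_pos])

lemma pos_le_iff [simp]: "pos p \<le> pos q \<longleftrightarrow> p \<le> q"
  by (rule strict_mono_less_eq[OF strict_mono_pos])

text \<open>Both polynomials have height 2. Infinitely many cells of equal length on each side of 0
  make the total length infinite in both directions.\<close>

lemma len_signed_monom: "len (monom 1 j) = 1 / 2" "len (- monom 1 j) = 1 / 2"
proof -
  have "(\<Sum>i\<le>j. real_of_int (if j = i then 1 else 0) ^ (2 ^ (i + 2))) = (\<Sum>i\<le>j. if j = i then 1 else 0)"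
    by (intro sum.cong) auto
  moreover have "(\<Sum>i\<le>j. real_of_int (- (if j = i then 1 else 0)) ^ (2 ^ (i + 2))) = (\<Sum>i\<le>j. if j = i then 1 else 0)"
    by (intro sum.cong) auto
  ultimately show "len (monom 1 j) = 1 / 2" "len (- monom 1 j) = 1 / 2"
    unfolding len_def height_def by (simp_all add: degree_monom_eq)
qed

lemma monom_1_pos: "0 < monom (1::int) i"
  by (rule poly_pos_intro[of _ i]) (auto simp: degree_monom_eq)

lemma monom_1_less: "i < j \<Longrightarrow> monom (1::int) i < monom 1 j"
  using poly_less_monom_Suc[of "monom 1 i" i j] by (simp add: degree_monom_eq)

lemma pos_monom_ge: "real j / 2 \<le> pos (monom 1 j)"
proof -
  have "sum len (monom 1 ` {..<j}) \<le> pos (monom 1 j) - pos 0"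
    by (intro sum_len_le_pos_diff) (auto intro: monom_1_less less_imp_le[OF monom_1_less] less_imp_le[OF monom_1_pos] monom_1_pos)
  moreover have "sum len (monom 1 ` {..<j}) = real j / 2"
    by (subst sum.reindex) (auto simp: inj_on_def len_signed_monom monom_eq_iff')
  ultimately show ?thesis by simp
qed

lemma pos_minus_monom_le: "pos (- monom 1 j) \<le> - real j / 2"
proof -
  have "sum len ((\<lambda>i. - monom 1 i) ` {..<j}) \<le> pos 0 - pos (- monom 1 j)"
    by (intro sum_len_le_pos_diff) (auto intro: monom_1_less less_imp_le[OF monom_1_less] less_imp_le[OF monom_1_pos] monom_1_pos)
  moreover have "sum len ((\<lambda>i. - monom 1 i) ` {..<j}) = real j / 2"
    by (subst sum.reindex) (auto simp: inj_on_def len_signed_monom monom_eq_iff')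
  ultimately show ?thesis by simp
qed

lemma between_pos_monom:
  obtains j where "pos (- monom 1 j) < x" "x < pos (monom 1 j)"
proof -
  obtain j where "2 * \<bar>x\<bar> < real j"
    using reals_Archimedean2 by blast
  then show thesis
    using that[of j] pos_monom_ge[of j] pos_minus_monom_le[of j] by linarith
qed

text \<open>Yoccoz's parametrization of \<open>(0, a)\<close> by the line: the maps
  \<open>cell_map b \<circ> cell_map a\<^sup>-\<^sup>1\<close> compose correctly, are tangent to the identity at both ends, and
  have derivative close to 1 when \<open>b / a\<close> is close to 1.\<close>

definition cell_map :: "real \<Rightarrow> real \<Rightarrow> real" where
  "cell_map a t = a / 2 + a / pi * arctan (a * t)"

text \<open>The derivative of \<open>cell_map b \<circ> cell_map a\<^sup>-\<^sup>1\<close> at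
  \<open>x\<close>, obtained from \<open>a * t = - cot (pi * x / a)\<close>. Written with sine and
  cosine it extends to the ends of the cell.\<close>

definition cell_deriv :: "real \<Rightarrow> real \<Rightarrow> real \<Rightarrow> real" where
  "cell_deriv a b x = 1 / ((a / b)\<^sup>2 * (sin (pi * x / a))\<^sup>2 + (cos (pi * x / a))\<^sup>2)"

lemma cell_map_bounds:
  assumes "0 < a"
  shows "0 < cell_map a t" "cell_map a t < a"
proof -
  have "cell_map a t = a * (1 / 2 + arctan (a * t) / pi)"
    by (simp add: cell_map_def algebra_simps)
  moreover have "- 1 / 2 < arctan (a * t) / pi" "arctan (a * t) / pi < 1 / 2"
    using arctan_lbound[of "a * t"] arctan_ubound[of "a * t"] by (auto simp: field_simps)
  ultimately show "0 < cell_map a t" "cell_map a t < a"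
    using assms mult_strict_left_mono[of "1 / 2 + arctan (a * t) / pi" 1 a]
      mult_pos_pos[of a "1 / 2 + arctan (a * t) / pi"] by linarith+
qed

lemma cell_map_surj:
  assumes "0 < a" "0 < x" "x < a"
  obtains t where "cell_map a t = x"
proof
  define y where "y = pi * (x / a - 1 / 2)"
  have "- (pi / 2) < y" "y < pi / 2"
    using assms by (auto simp: y_def field_simps)
  then have "arctan (tan y) = y"
    by (rule arctan_tan)
  then show "cell_map a (tan y / a) = x"
    using assms by (simp add: cell_map_def y_def field_simps)
qed

lemma cell_map_tendsto:
  assumes "0 < a"
  shows "(cell_map a \<longlongrightarrow> 0) at_bot" "(cell_map a \<longlongrightarrow> a) at_top"
proof -
  have bot: "filterlim (\<lambda>t. a * t) at_bot at_bot" and top: "filterlim (\<lambda>t. a * t) at_top at_top"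
    using assms by real_asymp+
  have "(cell_map a \<longlongrightarrow> a / 2 + a / pi * (- (pi / 2))) at_bot"
    unfolding cell_map_def
    by (intro tendsto_intros filterlim_compose[OF tendsto_arctan_at_bot bot])
  then show "(cell_map a \<longlongrightarrow> 0) at_bot" by simp
  have "(cell_map a \<longlongrightarrow> a / 2 + a / pi * (pi / 2)) at_top"
    unfolding cell_map_def
    by (intro tendsto_intros filterlim_compose[OF tendsto_arctan_at_top top])
  then show "(cell_map a \<longlongrightarrow> a) at_top" by simp
qed

lemma cell_map_deriv:
  "(cell_map a has_real_derivative a\<^sup>2 / (pi * (1 + (a * t)\<^sup>2))) (at t)"
proof -
  have "(cell_map a has_real_derivative 0 + a / pi * (inverse (1 + (a * t)\<^sup>2) * a)) (at t)"
    unfolding cell_map_def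
    by (intro DERIV_add DERIV_const DERIV_cmult DERIV_chain2[OF DERIV_arctan] DERIV_cmult_Id)
  then show ?thesis
    by (simp add: power2_eq_square inverse_eq_divide)
qed

lemma cell_denominator_pos:
  fixes a b y :: real
  assumes "0 < a" "0 < b"
  shows "0 < (a / b)\<^sup>2 * (sin y)\<^sup>2 + (cos y)\<^sup>2"
proof (cases "sin y = 0")
  case True
  then show ?thesis using sin_cos_squared_add[of y] by simp
next
  case False
  then show ?thesis using assms by (intro add_pos_nonneg mult_pos_pos) auto
qed

lemma cell_deriv_pos: "0 < a \<Longrightarrow> 0 < b \<Longrightarrow> 0 < cell_deriv a b x"
  by (simp add: cell_deriv_def cell_denominator_pos)

lemma cell_deriv_ends [simp]: "0 < a \<Longrightarrow> cell_deriv a b 0 = 1" "0 < a \<Longrightarrow> cell_deriv a b a = 1"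
  by (simp_all add: cell_deriv_def)

lemma continuous_on_cell_deriv:
  assumes "0 < a" "0 < b"
  shows "continuous_on S (cell_deriv a b)"
  unfolding cell_deriv_def
  using cell_denominator_pos[OF assms] assms
  by (intro continuous_intros) (auto simp: less_imp_neq[symmetric])

text \<open>This is the chain rule along the parameter \<open>t\<close>. With \<theta> = arctan (a *
  t), the angle \<open>pi * x / a\<close> is \<theta> + pi / 2, so its squared sine and cosine are
  rational in \<open>a * t\<close>.\<close>

lemma cell_deriv_cell_map:
  assumes "0 < a" "0 < b"
  shows "cell_deriv a b (cell_map a t) * (a\<^sup>2 / (pi * (1 + (a * t)\<^sup>2))) = b\<^sup>2 / (pi * (1 + (b * t)\<^sup>2))"
proof -
  define \<theta> where "\<theta> = arctan (a * t)"
  have arg: "pi * cell_map a t / a = \<theta> + pi / 2"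
    using assms by (simp add: cell_map_def \<theta>_def field_simps)
  have s: "sin (\<theta> + pi / 2) = cos \<theta>" and c: "cos (\<theta> + pi / 2) = - sin \<theta>"
    by (simp_all add: sin_add cos_add)
  have nz: "1 + (a * t)\<^sup>2 > 0" "1 + (b * t)\<^sup>2 > 0"
    by (auto intro: add_pos_nonneg)
  have cos2: "(cos \<theta>)\<^sup>2 = 1 / (1 + (a * t)\<^sup>2)"
    unfolding \<theta>_def cos_arctan using nz by (simp add: power_divide)
  have sin2: "(sin \<theta>)\<^sup>2 = (a * t)\<^sup>2 / (1 + (a * t)\<^sup>2)"
    unfolding \<theta>_def sin_arctan using nz by (simp add: power_divide)
  have "(a / b)\<^sup>2 * (cos \<theta>)\<^sup>2 + (sin \<theta>)\<^sup>2 = a\<^sup>2 * (1 + (b * t)\<^sup>2) / (b\<^sup>2 * (1 + (a * t)\<^sup>2))"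
    unfolding cos2 sin2 using assms nz by (simp add: divide_simps) (simp add: algebra_simps power2_eq_square)
  then have "cell_deriv a b (cell_map a t) = b\<^sup>2 * (1 + (a * t)\<^sup>2) / (a\<^sup>2 * (1 + (b * t)\<^sup>2))"
    unfolding cell_deriv_def arg s c by simp
  then show ?thesis
    using assms nz by (simp add: divide_simps)
qed

lemma cell_deriv_close_to_one:
  assumes "0 < \<epsilon>"
  obtains \<delta> where "0 < \<delta>"
    "\<And>a b x. 0 < a \<Longrightarrow> 0 < b \<Longrightarrow> \<bar>b / a - 1\<bar> < \<delta> \<Longrightarrow> \<bar>cell_deriv a b x - 1\<bar> < \<epsilon>"
proof
  \<comment> \<open>The error will be at most 10 * |\<rho> - 1|, hence below \<epsilon>. The bound 1
    / 2 keeps \<rho> between 1 / 2 and 3 / 2, which bounds the denominator below by 1 / 4.\<close>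
  define \<delta> where "\<delta> = min (1 / 2) (\<epsilon> / 12)"
  show "0 < \<delta>" using assms by (simp add: \<delta>_def)
  fix a b x :: real assume ab: "0 < a" "0 < b" and "\<bar>b / a - 1\<bar> < \<delta>"
  define \<rho> where "\<rho> = b / a"
  have \<rho>: "0 < \<rho>" "\<bar>\<rho> - 1\<bar> < \<delta>"
    using ab \<open>\<bar>b / a - 1\<bar> < \<delta>\<close> by (auto simp: \<rho>_def)
  have \<rho>12: "1 / 2 < \<rho>" "\<rho> < 3 / 2"
    using \<rho> unfolding \<delta>_def by linarith+
  define y where "y = pi * x / a"
  define s where "s = (sin y)\<^sup>2"
  have s: "0 \<le> s" "s \<le> 1" "(cos y)\<^sup>2 = 1 - s"
    by (auto simp: s_def abs_square_le_1 cos_squared_eq)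
  have "(a / b)\<^sup>2 = 1 / \<rho>\<^sup>2"
    using ab by (simp add: \<rho>_def power_divide)
  then have e: "cell_deriv a b x = 1 / (s / \<rho>\<^sup>2 + (1 - s))"
    unfolding cell_deriv_def y_def[symmetric] s(3) by (simp add: s_def)
  define D where "D = s + \<rho>\<^sup>2 * (1 - s)"
  have r2: "1 / 4 \<le> \<rho>\<^sup>2"
    using power_mono[of "1 / 2" \<rho> 2] \<rho>12 by (simp add: power2_eq_square)
  have "1 / 4 * s + 1 / 4 * (1 - s) \<le> D"
    unfolding D_def using s r2 by (intro add_mono mult_right_mono) auto
  then have D: "1 / 4 \<le> D" by argo
  have "cell_deriv a b x = \<rho>\<^sup>2 / D"
    unfolding e D_def using \<rho> by (simp add: field_simps)
  then have "cell_deriv a b x - 1 = (\<rho> - 1) * (\<rho> + 1) * s / D"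
    using D by (simp add: D_def field_simps power2_eq_square)
  then have "\<bar>cell_deriv a b x - 1\<bar> = \<bar>\<rho> - 1\<bar> * (\<rho> + 1) * s / D"
    using D s \<rho> by (simp add: abs_mult)
  also have "\<dots> \<le> \<bar>\<rho> - 1\<bar> * (5 / 2) * 1 / (1 / 4)"
    using D s \<rho>12 by (intro frac_le mult_mono) auto
  also have "\<dots> < \<epsilon>"
    using \<rho>(2) assms by (simp add: \<delta>_def)
  finally show "\<bar>cell_deriv a b x - 1\<bar> < \<epsilon>" .
qed

text \<open>In the parameter, \<open>F\<close> and the model have the same derivative, so their
  difference \<open>K\<close> is constant. Its limits at the two ends of the line identify the
  constant as \<open>F c\<close> and as \<open>F (c + a) - b\<close>.\<close>

lemma cell_transport:
  assumes ab: "0 < a" "0 < b"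
    and deriv: "\<And>x. c < x \<Longrightarrow> x < c + a \<Longrightarrow> (F has_real_derivative cell_deriv a b (x - c)) (at x)"
    and cont: "isCont F c" "isCont F (c + a)"
  shows "F (c + cell_map a t) = F c + cell_map b t" "F (c + a) = F c + b"
proof -
  define K where "K = (\<lambda>t. F (c + cell_map a t) - cell_map b t)"
  have "(K has_real_derivative 0) (at t)" for t
  proof -
    have F: "(F has_real_derivative cell_deriv a b (cell_map a t)) (at (c + cell_map a t))"
      using deriv[of "c + cell_map a t"] cell_map_bounds[OF ab(1), of t] by simp
    have "((\<lambda>t. c + cell_map a t) has_real_derivative a\<^sup>2 / (pi * (1 + (a * t)\<^sup>2))) (at t)"
      using DERIV_add[OF DERIV_const cell_map_deriv] by simp
    from DERIV_diff[OF DERIV_chain2[OF F this] cell_map_deriv[of b t]] show ?thesis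
      by (simp only: K_def cell_deriv_cell_map[OF ab] diff_self)
  qed
  then have const: "K s = K t" for s t
    using DERIV_isconst_all[of K s t] by blast
  have "(K \<longlongrightarrow> F (c + 0) - 0) at_bot"
    unfolding K_def using cont
    by (intro tendsto_intros isCont_tendsto_compose[of "c + 0" F] cell_map_tendsto ab) simp
  moreover have "(K \<longlongrightarrow> K t) at_bot" "(K \<longlongrightarrow> K t) at_top"
    using const[of _ t] by (auto intro: tendsto_eventually)
  moreover have "(K \<longlongrightarrow> F (c + a) - b) at_top"
    unfolding K_def using cont
    by (intro tendsto_intros isCont_tendsto_compose[of "c + a" F] cell_map_tendsto ab)
  ultimately have "K t = F (c + 0) - 0" "K t = F (c + a) - b"
    by (auto dest: tendsto_unique[rotated -1] intro: tendsto_unique[OF trivial_limit_at_bot_linorder] tendsto_unique[OF trivial_limit_at_top_linorder])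
  then show "F (c + cell_map a t) = F c + cell_map b t" "F (c + a) = F c + b"
    by (auto simp: K_def)
qed

section \<open>Density of the cells\<close>

definition pt :: "int poly \<Rightarrow> real \<Rightarrow> real" where
  "pt p t = pos p + cell_map (len p) t"

text \<open>Otherwise each cell would lie entirely left of \<open>s\<close> or right of
  \<open>t\<close>. The cells in \<open>{p..<q}\<close> would then have total length at most
  \<open>pos q - pos p - (t - s)\<close>, against \<open>pos_diff\<close>.\<close>

lemma pt_dense:
  assumes "s < t"
  obtains p \<tau> where "s < pt p \<tau>" "pt p \<tau> < t"
proof (rule ccontr)
  assume no: "\<not> thesis"
  have gap: "t \<le> pos r \<or> pos (r + 1) \<le> s" for r
  proof (rule ccontr)
    assume *: "\<not> (t \<le> pos r \<or> pos (r + 1) \<le> s)"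
    then have "max s (pos r) < min t (pos (r + 1))"
      using assms by simp
    then obtain x where x: "max s (pos r) < x" "x < min t (pos (r + 1))"
      using dense by blast
    then obtain \<tau> where "cell_map (len r) \<tau> = x - pos r"
      using cell_map_surj[OF len_pos, of "x - pos r" r] by (auto simp: pos_add_one)
    then have "pt r \<tau> = x" by (simp add: pt_def)
    then show False using that no x by force
  qed
  obtain i where i: "pos (- monom 1 i) < s" using between_pos_monom by blast
  obtain j where j: "t < pos (monom 1 j)" using between_pos_monom by blast
  define p q where "p = - monom (1::int) i" and "q = monom (1::int) j"
  have ps: "pos p < s" and qt: "t < pos q" and pq: "p \<le> q"
    using i j monom_1_pos[of i] monom_1_pos[of j] by (auto simp: p_def q_def)
  have "sum len F \<le> pos q - pos p - (t - s)" if F: "F \<subseteq> {p..<q}" "finite F" for F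
  proof -
    define A where "A = {r \<in> F. pos (r + 1) \<le> s}"
    define B where "B = {r \<in> F. \<not> pos (r + 1) \<le> s}"
    have fin: "finite A" "finite B" and F_eq: "F = A \<union> B" "A \<inter> B = {}"
      using F by (auto simp: A_def B_def)
    have "sum len A \<le> s - pos p"
    proof (cases "A = {}")
      case False
      have m: "Max A \<in> A" "\<And>r. r \<in> A \<Longrightarrow> r \<le> Max A"
        using fin False by auto
      \<comment> \<open>The right end of the last cell of \<open>A\<close> is used, so that this
        cell is counted too. By definition of \<open>A\<close> that end is at most
        \<open>s\<close>.\<close>
      have "sum len A \<le> pos (Max A + 1) - pos p"
      proof (rule sum_len_le_pos_diff)
        have "p \<le> Max A" using m(1) F by (auto simp: A_def)
        then show "p \<le> Max A + 1" by (simp add: add_increasing2)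
        show "A \<subseteq> {p..<Max A + 1}"
        proof
          fix r assume "r \<in> A"
          then have "r \<le> Max A" "r \<in> F"
            using m(2) by (auto simp: A_def)
          moreover have "Max A < Max A + 1" by simp
          ultimately show "r \<in> {p..<Max A + 1}"
            using F by (auto simp del: less_add_one intro: le_less_trans)
        qed
      qed (rule fin)
      then show ?thesis using m(1) by (simp add: A_def)
    qed (use ps in simp)
    moreover have "sum len B \<le> pos q - t"
    proof (cases "B = {}")
      case False
      have m: "Min B \<in> B" "\<And>r. r \<in> B \<Longrightarrow> Min B \<le> r"
        using fin False by auto
      have "sum len B \<le> pos q - pos (Min B)"
      proof (rule sum_len_le_pos_diff)
        show "Min B \<le> q" using m(1) F by (auto simp: B_def)
        show "B \<subseteq> {Min B..<q}"
          using m(2) F by (auto simp: B_def)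
      qed (rule fin)
      then show ?thesis using m(1) gap[of "Min B"] by (auto simp: B_def)
    qed (use qt in simp)
    ultimately show ?thesis
      unfolding F_eq(1) using sum.union_disjoint[OF fin F_eq(2), of len] by simp
  qed
  then have "infsum len {p..<q} \<le> pos q - pos p - (t - s)"
    by (intro infsum_le_finite_sums len_summable_interval) auto
  then show False
    using pos_diff[OF pq] assms by simp
qed

section \<open>Translations of the cells by continuously differentiable maps\<close>

lemma cell_unique:
  assumes "pos r < x" "x < pos (r + 1)" "pos s < x" "x < pos (s + 1)"
  shows "r = s"
proof -
  have "r < s + 1" "s < r + 1"
    using assms pos_less_iff[of r "s + 1"] pos_less_iff[of s "r + 1"] by (auto simp del: pos_less_iff)
  then show ?thesis
    using poly_add_one_le[of r s] poly_add_one_le[of s r] by force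
qed

text \<open>Clamping the argument extends \<open>cell_deriv - 1\<close> by 0, since \<open>cell_deriv\<close> is 1 at both ends of
  the cell.\<close>

definition bump :: "int poly \<Rightarrow> int poly \<Rightarrow> real \<Rightarrow> real" where
  "bump v r x = cell_deriv (len r) (len (r + v)) (max 0 (min (len r) (x - pos r))) - 1"

lemma isCont_bump: "isCont (bump v r) x"
proof -
  have "continuous_on UNIV (bump v r)"
    unfolding bump_def
    by (intro continuous_intros continuous_on_compose2[OF continuous_on_cell_deriv[of _ _ UNIV]] len_pos) auto
  then show ?thesis
    by (simp add: continuous_on_eq_continuous_at)
qed

lemma bump_nonzero_imp:
  assumes "bump v r x \<noteq> 0"
  shows "pos r < x" "x < pos (r + 1)"
proof -
  have "bump v r x = 0" if "x \<le> pos r \<or> pos (r + 1) \<le> x"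
    using that len_pos[of r] by (auto simp: bump_def pos_add_one max_def min_def len_pos)
  then show "pos r < x" "x < pos (r + 1)"
    using assms not_le by blast+
qed

lemma bump_cell:
  assumes "pos r < x" "x < pos (r + 1)"
  shows "bump v r x = cell_deriv (len r) (len (r + v)) (x - pos r) - 1"
  using assms by (simp add: bump_def pos_add_one max_def min_def)

text \<open>At each point at most one term is nonzero, namely that of the cell around it. The form
  as a sum permits uniform approximation by finite sums of continuous bumps.\<close>

definition shift_deriv :: "int poly \<Rightarrow> real \<Rightarrow> real" where
  "shift_deriv v x = 1 + infsum (\<lambda>r. bump v r x) UNIV"

lemma shift_deriv_cell:
  assumes "pos r < x" "x < pos (r + 1)"
  shows "shift_deriv v x = 1 + bump v r x"
proof -
  have "infsum (\<lambda>r. bump v r x) UNIV = infsum (\<lambda>r. bump v r x) {r}"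
    using bump_nonzero_imp cell_unique[OF assms] by (intro infsum_cong_neutral) blast+
  then show ?thesis by (simp add: shift_deriv_def)
qed

lemma shift_deriv_off_cells:
  assumes "\<And>r. bump v r x = 0"
  shows "shift_deriv v x = 1"
  by (simp add: shift_deriv_def assms)

lemma shift_deriv_pos: "0 < shift_deriv v x"
proof (cases "\<exists>r. bump v r x \<noteq> 0")
  case True
  then obtain r where r: "pos r < x" "x < pos (r + 1)"
    using bump_nonzero_imp by blast
  show ?thesis
    unfolding shift_deriv_cell[OF r] bump_cell[OF r] by (simp add: cell_deriv_pos len_pos)
qed (simp add: shift_deriv_off_cells)

text \<open>The cells are disjoint, so omitted bumps never add up at a point: the error is at most a
  single bump.\<close>

lemma shift_deriv_approx:
  assumes "finite F" "0 \<le> \<epsilon>" "\<And>r. r \<notin> F \<Longrightarrow> \<bar>bump v r x\<bar> \<le> \<epsilon>"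
  shows "\<bar>shift_deriv v x - (1 + (\<Sum>r\<in>F. bump v r x))\<bar> \<le> \<epsilon>"
proof (cases "\<exists>r. bump v r x \<noteq> 0")
  case True
  then obtain r where nz: "bump v r x \<noteq> 0" by blast
  note r = bump_nonzero_imp[OF nz]
  have "(\<Sum>s\<in>F. bump v s x) = (\<Sum>s\<in>F. if s = r then bump v r x else 0)"
    using bump_nonzero_imp cell_unique[OF r] by (intro sum.cong) force+
  also have "\<dots> = (if r \<in> F then bump v r x else 0)"
    using assms(1) by simp
  finally show ?thesis
    using assms(2,3) by (simp add: shift_deriv_cell[OF r])
qed (use assms(2) in \<open>simp add: shift_deriv_off_cells\<close>)

lemma bump_nonzero_between:
  assumes "bump v r x \<noteq> 0" "pos p \<le> x" "x \<le> pos q"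
  shows "r \<in> {p..<q}"
proof -
  have "pos p < pos (r + 1)" "pos r < pos q"
    using bump_nonzero_imp[OF assms(1)] assms(2,3) by linarith+
  then have "p < r + 1" "r < q" by simp_all
  then show ?thesis
    using poly_add_one_le[of r p] by force
qed

text \<open>A large bump forces \<open>len (r + v) / len r\<close> away from 1, which happens
  finitely often because degrees between \<open>p\<close> and \<open>q\<close> are bounded. This
  secures continuity of the derivative where cells accumulate.\<close>

lemma finite_large_bumps:
  assumes "0 < \<epsilon>"
  shows "finite {r \<in> {p..<q}. \<exists>x. \<epsilon> \<le> \<bar>bump v r x\<bar>}"
proof -
  obtain \<delta> where \<delta>: "0 < \<delta>"
    "\<And>a b x. 0 < a \<Longrightarrow> 0 < b \<Longrightarrow> \<bar>b / a - 1\<bar> < \<delta> \<Longrightarrow> \<bar>cell_deriv a b x - 1\<bar> < \<epsilon>"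
    using cell_deriv_close_to_one[OF assms] by blast
  have deg: "degree r \<le> max (degree p) (degree q)" if "r \<in> {p..<q}" for r
    using that by (intro degree_le_between[of p r q]) auto
  have far: "\<delta> \<le> \<bar>len (r + v) / len r - 1\<bar>" if "\<epsilon> \<le> \<bar>bump v r x\<bar>" for r x
    using that \<delta>(2)[OF len_pos[of r] len_pos[of "r + v"]] unfolding bump_def by (meson not_le)
  have "{r \<in> {p..<q}. \<exists>x. \<epsilon> \<le> \<bar>bump v r x\<bar>}
      \<subseteq> {r. degree r \<le> max (degree p) (degree q) \<and> \<delta> \<le> \<bar>len (r + v) / len r - 1\<bar>}"
    using deg far by blast
  then show ?thesis
    using finite_len_ratio_far[OF \<delta>(1)] by (rule finite_subset)
qed

lemma shift_deriv_uniform_approx: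
  assumes "0 < \<epsilon>"
  shows "\<forall>\<^sub>F F in finite_subsets_at_top {p..<q}.
    \<forall>x\<in>{pos p..pos q}. \<bar>shift_deriv v x - (1 + (\<Sum>r\<in>F. bump v r x))\<bar> \<le> \<epsilon>"
  unfolding eventually_finite_subsets_at_top
proof (intro exI conjI allI impI ballI)
  let ?F = "{r \<in> {p..<q}. \<exists>x. \<epsilon> \<le> \<bar>bump v r x\<bar>}"
  show "finite ?F" by (rule finite_large_bumps[OF assms])
  fix F x assume F: "finite F \<and> ?F \<subseteq> F \<and> F \<subseteq> {p..<q}" and x: "x \<in> {pos p..pos q}"
  have "\<bar>bump v r x\<bar> \<le> \<epsilon>" if "r \<notin> F" for r
  proof (cases "bump v r x = 0")
    case False
    then have "r \<in> {p..<q}"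
      using x by (intro bump_nonzero_between) auto
    then have "r \<notin> ?F \<Longrightarrow> \<bar>bump v r x\<bar> \<le> \<epsilon>"
      by (auto simp: not_le less_imp_le)
    then show ?thesis using that F by blast
  qed (use assms in simp)
  then show "\<bar>shift_deriv v x - (1 + (\<Sum>r\<in>F. bump v r x))\<bar> \<le> \<epsilon>"
    using F assms by (intro shift_deriv_approx) auto
qed auto

lemma isCont_shift_deriv: "isCont (shift_deriv v) x"
proof -
  obtain i where i: "pos (- monom 1 i) < x" using between_pos_monom by blast
  obtain j where j: "x < pos (monom 1 j)" using between_pos_monom by blast
  define p q where "p = - monom (1::int) i" and "q = monom (1::int) j"
  have "continuous_on {pos p..pos q} (shift_deriv v)"
  proof (rule uniform_limit_theorem)
    show "\<forall>\<^sub>F F in finite_subsets_at_top {p..<q}. continuous_on {pos p..pos q} (\<lambda>x. 1 + (\<Sum>r\<in>F. bump v r x))"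
      by (intro always_eventually allI continuous_intros continuous_at_imp_continuous_on ballI isCont_bump)
    show "uniform_limit {pos p..pos q} (\<lambda>F x. 1 + (\<Sum>r\<in>F. bump v r x)) (shift_deriv v) (finite_subsets_at_top {p..<q})"
      unfolding uniform_limit_iff
    proof (intro allI impI)
      fix e :: real assume "0 < e"
      then show "\<forall>\<^sub>F F in finite_subsets_at_top {p..<q}. \<forall>x\<in>{pos p..pos q}. dist (1 + (\<Sum>r\<in>F. bump v r x)) (shift_deriv v x) < e"
        using shift_deriv_uniform_approx[of "e / 2" p q v]
        by (auto simp: dist_real_def abs_minus_commute elim!: eventually_mono dest!: bspec)
    qed
  qed simp
  then have "continuous_on {pos p<..<pos q} (shift_deriv v)"
    by (rule continuous_on_subset) auto
  moreover have "x \<in> {pos p<..<pos q}"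
    using i j by (simp add: p_def q_def)
  ultimately show ?thesis
    using continuous_on_eq_continuous_at open_greaterThanLessThan by blast
qed

section \<open>Integration of the derivative\<close>

lemma continuous_antiderivative:
  fixes f :: "real \<Rightarrow> real"
  assumes "\<And>x. isCont f x"
  obtains F where "\<And>x. (F has_real_derivative f x) (at x)"
  using einterval_antiderivative[of "- \<infinity>" \<infinity> f] assms
  by (auto simp: has_real_derivative_iff_has_vector_derivative)

text \<open>The function \<open>x + h x\<close> meets the hypotheses of
  \<open>cell_transport\<close> on the cell of \<open>r\<close>, which it stretches from
  \<open>len r\<close> to \<open>len (r + v)\<close>; outside that cell \<open>h\<close> is
  constant.\<close>

lemma bump_antiderivative:
  assumes "r \<in> {p..<q}" and h: "\<And>x. (h has_real_derivative bump v r x) (at x)"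
  shows "h (pos q) - h (pos p) = len (r + v) - len r"
proof -
  have const: "h s = h t" if "s \<le> t" "\<And>x. s < x \<Longrightarrow> x < t \<Longrightarrow> x \<le> pos r \<or> pos (r + 1) \<le> x" for s t
  proof (cases "s = t")
    case False
    have "continuous_on {s..t} h"
      using h by (auto intro: DERIV_isCont continuous_at_imp_continuous_on)
    moreover have "(h has_real_derivative 0) (at x)" if "s < x" "x < t" for x
    proof -
      have "bump v r x = 0"
        using bump_nonzero_imp[of v r x] \<open>s < x \<Longrightarrow> x < t \<Longrightarrow> x \<le> pos r \<or> pos (r + 1) \<le> x\<close> that by force
      then show ?thesis using h[of x] by simp
    qed
    ultimately show ?thesis
      using DERIV_isconst_end[of s t h] False that(1) by simp
  qed simp
  have "p \<le> r" "r + 1 \<le> q"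
    using assms(1) poly_add_one_le by auto
  then have "h (pos p) = h (pos r)" "h (pos (r + 1)) = h (pos q)"
    by (auto intro!: const simp del: pos_less_iff)
  moreover have "pos r + len r + h (pos r + len r) = pos r + h (pos r) + len (r + v)"
  proof (rule cell_transport(2)[where c = "pos r" and F = "\<lambda>x. x + h x"])
    show "((\<lambda>x. x + h x) has_real_derivative cell_deriv (len r) (len (r + v)) (x - pos r)) (at x)"
      if "pos r < x" "x < pos r + len r" for x
      using DERIV_add[OF DERIV_ident h[of x]] bump_cell[of r x v] that by (simp add: pos_add_one)
    show "isCont (\<lambda>x. x + h x) (pos r)" "isCont (\<lambda>x. x + h x) (pos r + len r)"
      by (rule DERIV_isCont[OF DERIV_add[OF DERIV_ident h]])+
  qed (rule len_pos)+
  ultimately show ?thesis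
    by (simp add: pos_add_one)
qed

lemma has_sum_len_shift:
  assumes "p \<le> q"
  shows "((\<lambda>r. len (r + v) - len r) has_sum (pos (q + v) - pos (p + v) - (pos q - pos p))) {p..<q}"
proof -
  have im: "(\<lambda>r. r + v) ` {p..<q} = {p + v..<q + v}"
    by (auto simp: image_iff algebra_simps intro!: bexI[of _ "_ - v"])
  have inj: "inj_on (\<lambda>r. r + v) {p..<q}"
    by (auto simp: inj_on_def)
  have "(len has_sum (pos (q + v) - pos (p + v))) {p + v..<q + v}"
    using assms by (simp add: pos_diff has_sum_infsum len_summable_interval)
  then have "((\<lambda>r. len (r + v)) has_sum (pos (q + v) - pos (p + v))) {p..<q}"
    using has_sum_reindex[OF inj, of len, unfolded im o_def] by blast
  moreover have "(len has_sum (pos q - pos p)) {p..<q}"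
    using assms by (simp add: pos_diff has_sum_infsum len_summable_interval)
  ultimately show ?thesis
    using has_sum_add[OF _ has_sum_uminusI] by fastforce
qed

text \<open>As cells accumulate, knowing \<open>S\<close> on each cell up to a constant does not yet
  give its total increment. So \<open>S\<close> is compared with finite sums of bump
  antiderivatives: a uniform bound on the derivative of the difference makes the increments converge
  to the sum in \<open>has_sum_len_shift\<close>.\<close>

lemma shift_antiderivative:
  assumes S: "\<And>x. (S has_real_derivative shift_deriv v x) (at x)" and "p \<le> q"
  shows "S (pos q) - S (pos p) = pos (q + v) - pos (p + v)"
proof -
  define \<Delta> where "\<Delta> = S (pos q) - S (pos p) - (pos q - pos p)"
  have "\<exists>h. \<forall>x. (h has_real_derivative bump v r x) (at x)" for r
    using continuous_antiderivative[of "bump v r"] isCont_bump by metis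
  then obtain h where h: "\<And>r x. (h r has_real_derivative bump v r x) (at x)"
    by metis
  have le: "pos p \<le> pos q" using assms by simp
  have "((\<lambda>r. len (r + v) - len r) has_sum \<Delta>) {p..<q}"
    unfolding has_sum_def tendsto_iff
  proof (intro allI impI)
    fix e :: real assume e: "0 < e"
    \<comment> \<open>The summand 1 keeps the denominator positive when \<open>p = q\<close> and
      makes the accumulated error strictly less than \<open>e\<close>.\<close>
    define \<epsilon> where "\<epsilon> = e / (pos q - pos p + 1)"
    have \<epsilon>: "0 < \<epsilon>" "\<epsilon> * (pos q - pos p) < e"
      using e le by (auto simp: \<epsilon>_def divide_simps simp del: pos_le_iff)
    have ev: "\<forall>\<^sub>F F in finite_subsets_at_top {p..<q}. finite F \<and> F \<subseteq> {p..<q}"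
      by (auto simp: eventually_finite_subsets_at_top)
    show "\<forall>\<^sub>F F in finite_subsets_at_top {p..<q}. dist (\<Sum>r\<in>F. len (r + v) - len r) \<Delta> < e"
      using ev shift_deriv_uniform_approx[OF \<epsilon>(1), of p q v]
    proof eventually_elim
      case (elim F)
      define D where "D = (\<lambda>x. S x - (x + (\<Sum>r\<in>F. h r x)))"
      have "norm (D (pos q) - D (pos p)) \<le> \<epsilon> * norm (pos q - pos p)"
      proof (rule field_differentiable_bound)
        show "(D has_field_derivative shift_deriv v x - (1 + (\<Sum>r\<in>F. bump v r x))) (at x within {pos p..pos q})" for x
          unfolding D_def by (rule has_field_derivative_at_within) (intro DERIV_diff S DERIV_add DERIV_ident DERIV_sum h)
        show "norm (shift_deriv v x - (1 + (\<Sum>r\<in>F. bump v r x))) \<le> \<epsilon>" if "x \<in> {pos p..pos q}" for x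
          using elim that by simp
      qed (use le in auto)
      moreover have "D (pos q) - D (pos p) = \<Delta> - (\<Sum>r\<in>F. h r (pos q) - h r (pos p))"
        by (simp add: D_def \<Delta>_def sum_subtractf)
      moreover have "(\<Sum>r\<in>F. h r (pos q) - h r (pos p)) = (\<Sum>r\<in>F. len (r + v) - len r)"
        using elim h by (intro sum.cong bump_antiderivative) auto
      ultimately show ?case
        using \<epsilon>(2) le by (simp add: dist_real_def abs_minus_commute)
    qed
  qed
  then have "\<Delta> = pos (q + v) - pos (p + v) - (pos q - pos p)"
    using has_sum_len_shift[OF assms(2), of v] by (rule has_sum_unique)
  then show ?thesis by (simp add: \<Delta>_def)
qed

lemma shift_exists:
  obtains T where "\<And>x. (T has_real_derivative shift_deriv v x) (at x)"
    "\<And>p. T (pos p) = pos (p + v)" "\<And>p t. T (pt p t) = pt (p + v) t"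
proof -
  obtain S where S: "\<And>x. (S has_real_derivative shift_deriv v x) (at x)"
    using continuous_antiderivative isCont_shift_deriv by metis
  \<comment> \<open>The constant gives \<open>T 0 = pos v\<close>. Since \<open>pos 0 = 0\<close>,
    this places one left end correctly, and \<open>shift_antiderivative\<close> places the
    others.\<close>
  define T where "T = (\<lambda>x. S x + (pos v - S 0))"
  have T: "(T has_real_derivative shift_deriv v x) (at x)" for x
    unfolding T_def using DERIV_add[OF S DERIV_const] by simp
  have pos: "T (pos p) = pos (p + v)" for p
    using shift_antiderivative[OF S, of 0 p] shift_antiderivative[OF S, of p 0] linear[of 0 p]
    by (auto simp: T_def)
  have "T (pos p + cell_map (len p) t) = T (pos p) + cell_map (len (p + v)) t" for p t
  proof (rule cell_transport(1))
    show "(T has_real_derivative cell_deriv (len p) (len (p + v)) (x - pos p)) (at x)"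
      if "pos p < x" "x < pos p + len p" for x
      using T[of x] shift_deriv_cell[of p x v] bump_cell[of p x v] that by (simp add: pos_add_one)
    show "isCont T (pos p)" "isCont T (pos p + len p)"
      by (rule DERIV_isCont[OF T])+
  qed (rule len_pos)+
  then have "T (pt p t) = pt (p + v) t" for p t
    by (simp add: pt_def pos)
  with T pos show thesis by (rule that)
qed


section \<open>The action of the polynomials on the line\<close>

definition shift :: "int poly \<Rightarrow> real \<Rightarrow> real" where
  "shift v = (SOME T. (\<forall>x. (T has_real_derivative shift_deriv v x) (at x)) \<and>
    (\<forall>p. T (pos p) = pos (p + v)) \<and> (\<forall>p t. T (pt p t) = pt (p + v) t))"

lemma shift_spec:
  shows shift_has_derivative: "(shift v has_real_derivative shift_deriv v x) (at x)"
    and shift_pos: "shift v (pos p) = pos (p + v)"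
    and shift_pt: "shift v (pt p t) = pt (p + v) t"
proof -
  have "\<exists>T. (\<forall>x. (T has_real_derivative shift_deriv v x) (at x)) \<and>
    (\<forall>p. T (pos p) = pos (p + v)) \<and> (\<forall>p t. T (pt p t) = pt (p + v) t)"
    using shift_exists[of v] by metis
  from someI_ex[OF this]
  show "(shift v has_real_derivative shift_deriv v x) (at x)"
    "shift v (pos p) = pos (p + v)" "shift v (pt p t) = pt (p + v) t"
    unfolding shift_def by blast+
qed

lemma isCont_shift: "isCont (shift v) x"
  by (rule DERIV_isCont[OF shift_has_derivative])

lemma continuous_on_shift: "continuous_on S (shift v)"
  by (simp add: continuous_at_imp_continuous_on isCont_shift)

lemma strict_mono_shift: "strict_mono (shift v)"
proof (rule strict_monoI)
  fix x y :: real assume "x < y"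
  then show "shift v x < shift v y"
    by (rule DERIV_pos_imp_increasing) (use shift_has_derivative shift_deriv_pos in blast)
qed

lemma shift_less_iff [simp]: "shift v x < shift v y \<longleftrightarrow> x < y"
  by (rule strict_mono_less[OF strict_mono_shift])

lemma shift_le_iff [simp]: "shift v x \<le> shift v y \<longleftrightarrow> x \<le> y"
  by (rule strict_mono_less_eq[OF strict_mono_shift])

text \<open>The points \<open>pt p t\<close> are dense by \<open>pt_dense\<close>. Translations
  satisfy the exact formula \<open>shift_pt\<close> on them, so the group law follows from addition
  of polynomials.\<close>

lemma continuous_eq_if_eq_on_pts:
  fixes f g :: "real \<Rightarrow> real"
  assumes "continuous_on UNIV f" "continuous_on UNIV g" "\<And>p t. f (pt p t) = g (pt p t)"
  shows "f x = g x"
proof (rule ccontr)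
  assume ne: "f x \<noteq> g x"
  have "open {y. f y \<noteq> g y}"
    using assms(1,2) by (intro open_Collect_neq)
  then obtain e where e: "0 < e" "ball x e \<subseteq> {y. f y \<noteq> g y}"
    using ne open_contains_ball by blast
  obtain p t where "x < pt p t" "pt p t < x + e"
    using pt_dense[of x "x + e"] e(1) by auto
  then have "pt p t \<in> ball x e"
    by (simp add: dist_real_def)
  then show False using e(2) assms(3) by blast
qed

lemma shift_shift: "shift v (shift w x) = shift (v + w) x"
  by (rule continuous_eq_if_eq_on_pts)
    (auto simp: shift_pt algebra_simps intro!: continuous_on_shift continuous_on_compose2[OF continuous_on_shift[of UNIV]])

lemma shift_0: "shift 0 x = x"
  by (rule continuous_eq_if_eq_on_pts) (auto simp: shift_pt intro: continuous_on_shift)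

lemma shift_inject: "shift v = shift w \<longleftrightarrow> v = w"
proof
  assume "shift v = shift w"
  then have "pos v = pos w"
    using shift_pos[of v 0] shift_pos[of w 0] by simp
  then show "v = w"
    using strict_mono_eq[OF strict_mono_pos] by blast
qed simp

lemma bij_shift: "bij (shift v)"
  by (rule bij_betw_byWitness[of _ "shift (- v)"]) (auto simp: shift_shift shift_0)

lemma shift_C1: "shift v C1_differentiable_on UNIV"
  unfolding C1_differentiable_on_def
  using shift_has_derivative isCont_shift_deriv
  by (intro exI[of _ "shift_deriv v"] conjI ballI continuous_at_imp_continuous_on)
    (auto simp: has_real_derivative_iff_has_vector_derivative)

lemma homeomorphism_shift: "homeomorphism UNIV UNIV (shift v) (shift (- v))"
  using bij_shift by (auto simp: homeomorphism_def shift_shift shift_0 continuous_on_shift bij_def)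

lemma shift_C1_diffeo: "orientation_preserving_C1_diffeo (shift v)"
  unfolding orientation_preserving_C1_diffeo_def
  using homeomorphism_shift shift_C1 strict_mono_shift by blast

lemma shift_homeo: "orientation_preserving_homeo (shift v)"
  unfolding orientation_preserving_homeo_def
  using homeomorphism_shift strict_mono_shift by blast

section \<open>The translation group\<close>

lemma shift_in_Bij: "shift v \<in> Bij UNIV"
  using bij_shift by (simp add: Bij_def)

lemma BijGroup_mult_shift: "shift v \<otimes>\<^bsub>BijGroup UNIV\<^esub> shift w = shift (v + w)"
  by (simp add: BijGroup_def shift_in_Bij compose_def shift_shift restrict_def)

lemma BijGroup_one: "\<one>\<^bsub>BijGroup UNIV\<^esub> = shift 0"
  by (simp add: BijGroup_def restrict_def shift_0 fun_eq_iff)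

lemma BijGroup_inv_shift: "inv\<^bsub>BijGroup UNIV\<^esub> (shift v) = shift (- v)"
  using shift_in_Bij
  by (intro group.inv_equality[OF group_BijGroup])
    (auto simp: BijGroup_mult_shift BijGroup_one, auto simp: BijGroup_def)

lemma subgroup_shift_image:
  assumes "0 \<in> V" "\<And>v w. v \<in> V \<Longrightarrow> w \<in> V \<Longrightarrow> v + w \<in> V" "\<And>v. v \<in> V \<Longrightarrow> - v \<in> V"
  shows "subgroup (shift ` V) (BijGroup UNIV)"
proof
  show "shift ` V \<subseteq> carrier (BijGroup UNIV)"
    using shift_in_Bij by (auto simp: BijGroup_def)
qed (use assms in \<open>auto simp: BijGroup_mult_shift BijGroup_one BijGroup_inv_shift\<close>)

lemma subgroup_shift: "subgroup (range shift) (BijGroup UNIV)"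
  by (rule subgroup_shift_image) auto

lemma comm_group_shift: "comm_group (transformation_group (range shift))"
proof (rule group.group_comm_groupI)
  show "group (transformation_group (range shift))"
    by (rule subgroup.subgroup_is_group[OF subgroup_shift group_BijGroup])
qed (auto simp: BijGroup_mult_shift add.commute)

text \<open>Finitely many polynomials have degree at most some \<open>d\<close>, and the polynomials
  of degree at most \<open>d\<close> form a subgroup without x ^ (d + 1).\<close>

lemma not_finitely_generated_shift: "\<not> finitely_generated (transformation_group (range shift))"
proof
  assume "finitely_generated (transformation_group (range shift))"
  then obtain S where S: "finite S" "S \<subseteq> range shift" "generate (transformation_group (range shift)) S = range shift"
    by (auto simp: finitely_generated_def)
  then obtain V where V: "finite V" "S = shift ` V"
    by (meson finite_subset_image)
  define d where "d = Max (insert 0 (degree ` V))"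
  define H where "H = shift ` {v. degree v \<le> d}"
  have sub: "subgroup H (BijGroup UNIV)"
    unfolding H_def by (rule subgroup_shift_image) (auto intro: degree_add_le)
  have "S \<subseteq> H"
    using V by (auto simp: H_def d_def intro!: imageI)
  have "generate (transformation_group (range shift)) S = generate (BijGroup UNIV) S"
    using group.generate_consistent[OF group_BijGroup S(2) subgroup_shift] by simp
  also have "\<dots> \<subseteq> H"
    using \<open>S \<subseteq> H\<close> sub by (rule group.generate_subgroup_incl[OF group_BijGroup])
  finally have "shift (monom 1 (Suc d)) \<in> H"
    using S(3) by blast
  then show False
    by (auto simp: H_def shift_inject degree_monom_eq)
qed

section \<open>The tower\<close>

text \<open>Left ends of cells suffice for both ends of the hull: the polynomials of degree at most
  \<open>j\<close> are stable under adding and subtracting 1, so right ends are left ends too and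
  neither bound is attained.\<close>

definition lower_end :: "nat \<Rightarrow> real" where
  "lower_end j = Inf (pos ` {p. degree p \<le> j})"

definition upper_end :: "nat \<Rightarrow> real" where
  "upper_end j = Sup (pos ` {p. degree p \<le> j})"

lemma bdd_pos_degree_le: "bdd_below (pos ` {p. degree p \<le> j})" "bdd_above (pos ` {p. degree p \<le> j})"
  by (auto intro!: bdd_belowI[of _ "pos (- monom 1 (Suc j))"] bdd_aboveI[of _ "pos (monom 1 (Suc j))"]
      less_imp_le[OF poly_less_monom_Suc] less_imp_le[OF monom_Suc_less_poly])

lemma degree_le_nonempty: "pos ` {p. degree p \<le> j} \<noteq> {}"
  by (auto intro: exI[of _ 0])

lemma lower_end_less_pos:
  assumes "degree p \<le> j"
  shows "lower_end j < pos p"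
proof -
  have "lower_end j \<le> pos (p - 1)"
    unfolding lower_end_def using assms by (intro cInf_lower bdd_pos_degree_le imageI) (simp add: degree_diff_le)
  also have "\<dots> < pos p" by simp
  finally show ?thesis .
qed

lemma pos_less_upper_end:
  assumes "degree p \<le> j"
  shows "pos p < upper_end j"
proof -
  have "pos p < pos (p + 1)" by simp
  also have "\<dots> \<le> upper_end j"
    unfolding upper_end_def using assms by (intro cSup_upper bdd_pos_degree_le imageI) (simp add: degree_add_le)
  finally show ?thesis .
qed

lemma lower_end_ge: "(\<And>p. degree p \<le> j \<Longrightarrow> c \<le> pos p) \<Longrightarrow> c \<le> lower_end j"
  unfolding lower_end_def by (intro cInf_greatest degree_le_nonempty) auto

lemma upper_end_le: "(\<And>p. degree p \<le> j \<Longrightarrow> pos p \<le> c) \<Longrightarrow> upper_end j \<le> c"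
  unfolding upper_end_def by (intro cSup_least degree_le_nonempty) auto

lemma lower_end_less_iff: "lower_end j < x \<longleftrightarrow> (\<exists>p. degree p \<le> j \<and> pos p < x)"
  unfolding lower_end_def using cInf_less_iff[OF degree_le_nonempty bdd_pos_degree_le(1)] by auto

lemma less_upper_end_iff: "x < upper_end j \<longleftrightarrow> (\<exists>p. degree p \<le> j \<and> x < pos p)"
  unfolding upper_end_def using less_cSup_iff[OF degree_le_nonempty bdd_pos_degree_le(2)] by auto

lemma lower_less_upper: "lower_end j < upper_end j"
  using lower_end_less_pos[of 0 j] pos_less_upper_end[of 0 j] by simp

text \<open>Translation by \<open>v\<close> permutes the left ends of the cells of degree at most
  \<open>j\<close>, so it cannot lower their supremum. The same holds for \<open>- v\<close>, and
  together these give a fixed point.\<close>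

lemma shift_upper_end:
  assumes "degree v \<le> j"
  shows "shift v (upper_end j) = upper_end j"
proof -
  have ge: "upper_end j \<le> shift w (upper_end j)" if w: "degree w \<le> j" for w
  proof (rule upper_end_le)
    fix p :: "int poly" assume "degree p \<le> j"
    then have "pos (p - w) \<le> upper_end j"
      using w by (intro less_imp_le[OF pos_less_upper_end] degree_diff_le)
    then have "shift w (pos (p - w)) \<le> shift w (upper_end j)" by simp
    then show "pos p \<le> shift w (upper_end j)" by (simp add: shift_pos)
  qed
  have "upper_end j \<le> shift (- v) (upper_end j)"
    using assms by (intro ge) simp
  then have "shift v (upper_end j) \<le> shift v (shift (- v) (upper_end j))"
    by (simp only: shift_le_iff)
  then show ?thesis
    using ge[OF assms] by (simp add: shift_shift shift_0)
qed

lemma shift_lower_end: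
  assumes "degree v \<le> j"
  shows "shift v (lower_end j) = lower_end j"
proof -
  have le: "shift w (lower_end j) \<le> lower_end j" if w: "degree w \<le> j" for w
  proof (rule lower_end_ge)
    fix p :: "int poly" assume "degree p \<le> j"
    then have "lower_end j \<le> pos (p - w)"
      using w by (intro less_imp_le[OF lower_end_less_pos] degree_diff_le)
    then have "shift w (lower_end j) \<le> shift w (pos (p - w))" by simp
    then show "shift w (lower_end j) \<le> pos p" by (simp add: shift_pos)
  qed
  have "shift (- v) (lower_end j) \<le> lower_end j"
    using assms by (intro le) simp
  then have "shift v (shift (- v) (lower_end j)) \<le> shift v (lower_end j)"
    by (simp only: shift_le_iff)
  then show ?thesis
    using le[OF assms] by (simp add: shift_shift shift_0)
qed

lemma shift_multiple_passes:
  assumes "pos p < x" "degree p \<le> j" "degree q \<le> j"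
  obtains n where "pos q < shift (of_nat n * monom 1 j) x"
proof -
  obtain n where "q - p < of_nat n * monom 1 j"
    using poly_less_monom_multiple[of "q - p" j] assms by (auto intro: degree_diff_le)
  then have "pos q < shift (of_nat n * monom 1 j) (pos p)"
    by (simp add: shift_pos algebra_simps)
  also have "\<dots> < shift (of_nat n * monom 1 j) x"
    using assms by simp
  finally show thesis by (rule that)
qed

text \<open>An interior fixed point would be fixed by all multiples of x ^ j, yet some multiple
  carries it beyond a left end \<open>pos q\<close> that lies above it.\<close>

lemma Fix_shift_monom: "Fix (shift (monom 1 j)) \<inter> {lower_end j..upper_end j} = {lower_end j, upper_end j}"
proof
  show "{lower_end j, upper_end j} \<subseteq> Fix (shift (monom 1 j)) \<inter> {lower_end j..upper_end j}"
    using lower_less_upper[of j] by (auto simp: Fix_def shift_upper_end shift_lower_end degree_monom_eq)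
  show "Fix (shift (monom 1 j)) \<inter> {lower_end j..upper_end j} \<subseteq> {lower_end j, upper_end j}"
  proof (rule ccontr)
    assume "\<not> ?thesis"
    then obtain x where x: "shift (monom 1 j) x = x" "lower_end j < x" "x < upper_end j"
      by (force simp: Fix_def)
    have fix_multiple: "shift (of_nat n * monom 1 j) x = x" for n
    proof (induction n)
      case (Suc n)
      have "shift (of_nat (Suc n) * monom 1 j) x = shift (of_nat n * monom 1 j) (shift (monom 1 j) x)"
        by (simp add: shift_shift algebra_simps)
      then show ?case using Suc x(1) by simp
    qed (simp add: shift_0)
    obtain p where p: "degree p \<le> j" "pos p < x"
      using x(2) lower_end_less_iff by blast
    obtain q where q: "degree q \<le> j" "x < pos q"
      using x(3) less_upper_end_iff by blast
    show False
      using shift_multiple_passes[OF p(2,1) q(1)] fix_multiple q(2) by (metis less_asym)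
  qed
qed

lemma infinite_tower_shift: "infinite_tower lower_end upper_end (\<lambda>j. shift (monom 1 j))"
  unfolding infinite_tower_def
proof (intro conjI allI)
  fix j
  \<comment> \<open>The left end of the cell of x ^ (j + 1) separates \<open>upper_end j\<close>
    from \<open>upper_end (Suc j)\<close>, which makes the inclusion strict.\<close>
  have "upper_end j \<le> pos (monom 1 (Suc j))"
    by (intro upper_end_le) (simp add: poly_less_monom_Suc less_imp_le)
  then have up: "upper_end j < upper_end (Suc j)"
    using pos_less_upper_end[of "monom 1 (Suc j)" "Suc j"] by (simp add: degree_monom_eq)
  have "pos (- monom 1 (Suc j)) \<le> lower_end j"
    by (intro lower_end_ge) (simp add: monom_Suc_less_poly less_imp_le)
  then have low: "lower_end (Suc j) < lower_end j"
    using lower_end_less_pos[of "- monom 1 (Suc j)" "Suc j"] by (simp add: degree_monom_eq)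
  show "{lower_end j..upper_end j} \<subset> {lower_end (Suc j)..upper_end (Suc j)}"
    using up low lower_less_upper[of j] by (auto simp: psubset_eq)
qed (simp_all add: lower_less_upper shift_homeo Fix_shift_monom)

lemma inside_tower:
  obtains j where "lower_end j < x" "x < upper_end j"
proof -
  obtain j where j: "pos (- monom 1 j) < x" "x < pos (monom 1 j)"
    using between_pos_monom by blast
  show thesis
  proof
    show "lower_end j < x" using j(1) by (auto simp: lower_end_less_iff degree_monom_eq intro!: exI[of _ "- monom 1 j"])
    show "x < upper_end j" using j(2) by (auto simp: less_upper_end_iff degree_monom_eq intro!: exI[of _ "monom 1 j"])
  qed
qed

section \<open>Absence of invariant measures and minimal sets\<close>

lemma shift_image_pos_interval: "shift v ` {pos p..<pos q} = {pos (p + v)..<pos (q + v)}"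
proof
  show "{pos (p + v)..<pos (q + v)} \<subseteq> shift v ` {pos p..<pos q}"
  proof
    fix x assume x: "x \<in> {pos (p + v)..<pos (q + v)}"
    have "shift (- v) (pos (p + v)) \<le> shift (- v) x" "shift (- v) x < shift (- v) (pos (q + v))"
      using x by (simp_all del: shift_pos)
    then have "shift (- v) x \<in> {pos p..<pos q}"
      by (simp add: shift_pos)
    moreover have "x = shift v (shift (- v) x)"
      by (simp add: shift_shift shift_0)
    ultimately show "x \<in> shift v ` {pos p..<pos q}" by blast
  qed
qed (auto simp flip: shift_pos)

text \<open>The translates by natural multiples of \<open>x ^ j\<close> are disjoint
  and stay below \<open>pos (p + x ^ (j + 1))\<close>, hence in a compact set.\<close>

lemma invariant_measure_interval_null:
  assumes M: "radon_measure M" "invariant_measure (range shift) M"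
  shows "emeasure M {pos p..<pos (p + monom 1 j)} = 0"
proof (rule ccontr)
  define m where "m = (monom 1 j :: int poly)"
  define A where "A = (\<lambda>i. {pos (p + of_nat i * m)..<pos (p + m + of_nat i * m)})"
  assume "emeasure M {pos p..<pos (p + monom 1 j)} \<noteq> 0"
  then have A0: "emeasure M (A 0) \<noteq> 0"
    by (simp add: A_def m_def)
  have m: "0 < m" by (simp add: m_def monom_1_pos)
  have sets: "sets M = sets borel" using M(1) by (simp add: radon_measure_def)
  define K where "K = {pos p..pos (p + monom 1 (Suc j))}"
  have K: "emeasure M K < \<infinity>"
    using M(1) by (simp add: radon_measure_def K_def)
  have A: "emeasure M (A i) = emeasure M (A 0)" for i
  proof -
    have "A i = shift (of_nat i * m) ` A 0"
      by (simp add: A_def shift_image_pos_interval)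
    then show ?thesis
      using M(2) by (simp add: invariant_measure_def A_def)
  qed
  have disj: "disjoint_family A"
  proof -
    have "A i \<inter> A k = {}" if "i < k" for i k
    proof -
      have "of_nat (Suc i) * m \<le> of_nat k * m"
        using that m by (intro mult_right_mono) (auto simp: of_nat_le_iff simp del: of_nat_Suc)
      then have "pos (p + m + of_nat i * m) \<le> pos (p + of_nat k * m)"
        by (simp add: algebra_simps)
      then show ?thesis by (auto simp: A_def)
    qed
    then show ?thesis
      unfolding disjoint_family_on_def by (metis Int_commute linorder_neqE_nat)
  qed
  have AK: "A i \<subseteq> K" for i
  proof -
    have "m + of_nat i * m < monom 1 (Suc j)"
      unfolding m_def by (intro poly_less_monom_Suc[of _ j] degree_add_le) (auto simp: of_nat_poly degree_monom_eq)
    then have "pos (p + m + of_nat i * m) \<le> pos (p + monom 1 (Suc j))"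
      by (simp add: algebra_simps)
    moreover have "pos p \<le> pos (p + of_nat i * m)"
      using m by simp
    ultimately show ?thesis by (auto simp: A_def K_def simp del: pos_le_iff)
  qed
  have le: "of_nat n * emeasure M (A 0) \<le> emeasure M K" for n :: nat
  proof -
    have "of_nat n * emeasure M (A 0) = (\<Sum>i<n. emeasure M (A i))"
      by (subst A) simp
    also have "\<dots> = emeasure M (\<Union>i<n. A i)"
      using disj by (intro sum_emeasure) (auto simp: sets A_def disjoint_family_on_def)
    also have "\<dots> \<le> emeasure M K"
      using AK by (intro emeasure_mono) (auto simp: sets K_def)
    finally show ?thesis .
  qed
  have "emeasure M (A 0) < \<infinity>"
    using le[of 1] K by simp
  then obtain c where c: "emeasure M (A 0) = ennreal c" "0 \<le> c"
    by (cases "emeasure M (A 0)") auto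
  obtain C where C: "emeasure M K = ennreal C" "0 \<le> C"
    using K by (cases "emeasure M K") auto
  have "0 < c" using A0 c by (cases "c = 0") auto
  then obtain n :: nat where "C < real n * c"
    using reals_Archimedean3 by blast
  moreover have "real n * c \<le> C"
    using le[of n] c C by (simp add: ennreal_of_nat_eq_real_of_nat flip: ennreal_mult)
  ultimately show False by simp
qed

lemma no_invariant_radon_measure:
  assumes "radon_measure M" "invariant_measure (range shift) M"
  shows "emeasure M UNIV = 0"
proof -
  have sets: "sets M = sets borel" using assms(1) by (simp add: radon_measure_def)
  \<comment> \<open>The previous lemma treats order intervals of extent x ^ j. One is placed on each
    side of 0, and countably many such pairs cover the line.\<close>
  define B where "B = (\<lambda>j. {pos (- monom 1 j)..<0} \<union> {0..<pos (monom 1 j)})"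
  have "B j \<in> null_sets M" for j
    unfolding B_def
    using invariant_measure_interval_null[OF assms, of "- monom 1 j" j]
      invariant_measure_interval_null[OF assms, of 0 j]
    by (intro null_sets.Un null_setsI) (auto simp: sets)
  then have "(\<Union>j. B j) \<in> null_sets M"
    by (intro null_sets_UN) auto
  moreover have "(\<Union>j. B j) = UNIV"
  proof -
    have "x \<in> (\<Union>j. B j)" for x
    proof -
      obtain j where "pos (- monom 1 j) < x" "x < pos (monom 1 j)"
        using between_pos_monom by blast
      then have "x \<in> B j" by (auto simp: B_def)
      then show ?thesis by blast
    qed
    then show ?thesis by blast
  qed
  ultimately show ?thesis by (simp add: null_setsD1)
qed

text \<open>A \<open>v\<close> of degree at most \<open>j\<close> fixes the end. One of larger
  degree exceeds in absolute value all differences of polynomials of degree at most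
  \<open>j\<close>, so the image lies at or beyond an end of the hull, on the side given by the sign
  of \<open>v\<close>.\<close>

lemma shift_upper_end_outside: "shift v (upper_end j) \<notin> {lower_end j<..<upper_end j}"
proof (cases "degree v \<le> j")
  case True
  then show ?thesis by (simp add: shift_upper_end)
next
  case False
  then have "v \<noteq> 0" by auto
  then consider "0 < v" | "v < 0" by (meson neq_iff)
  then show ?thesis
  proof cases
    case 1
    have "upper_end j \<le> pos v"
    proof (rule upper_end_le)
      fix p :: "int poly" assume "degree p \<le> j"
      then have "\<not> v \<le> p"
        using degree_le_between[of 0 v p j] False 1 by auto
      then show "pos p \<le> pos v" by simp
    qed
    also have "\<dots> = shift v (pos 0)"
      by (simp add: shift_pos del: pos_0)
    also have "\<dots> \<le> shift v (upper_end j)"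
      using pos_less_upper_end[of 0 j] by (simp del: pos_0)
    finally show ?thesis by simp
  next
    case 2
    have "shift v (upper_end j) \<le> lower_end j"
    proof (rule lower_end_ge)
      fix q :: "int poly" assume q: "degree q \<le> j"
      have "upper_end j \<le> pos (q - v)"
      proof (rule upper_end_le)
        fix p :: "int poly" assume "degree p \<le> j"
        then have "\<not> q - p \<le> v"
          using degree_le_between[of "q - p" v 0 j] degree_diff_le[OF q] False 2 by auto
        then show "pos p \<le> pos (q - v)" by (simp add: algebra_simps)
      qed
      then have "shift v (upper_end j) \<le> shift v (pos (q - v))"
        by simp
      then show "shift v (upper_end j) \<le> pos q"
        by (simp add: shift_pos)
    qed
    then show ?thesis by simp
  qed
qed

lemma no_closed_minimal_set: "\<not> closed_minimal_set (range shift) A"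
proof
  assume min: "closed_minimal_set (range shift) A"
  then have "A \<noteq> {}" "closed A" and inv: "\<And>v. shift v ` A = A"
    by (auto simp: closed_minimal_set_def invariant_set_def)
  then obtain x where x: "x \<in> A" by blast
  obtain j where j: "lower_end j < x" "x < upper_end j"
    using inside_tower by blast
  \<comment> \<open>The points of \<open>A\<close> whose orbits avoid the interior of the interval
    around \<open>x\<close>. This closed invariant set contains \<open>upper_end j\<close> but not
    \<open>x\<close>, contradicting minimality.\<close>
  define B where "B = {y \<in> A. \<forall>v. shift v y \<notin> {lower_end j<..<upper_end j}}"
  \<comment> \<open>Multiples of x ^ j push \<open>x\<close> past every left end
    \<open>pos q\<close> with \<open>q\<close> of degree at most \<open>j\<close>, but not past the
    fixed point \<open>upper_end j\<close>, so the orbit of \<open>x\<close> accumulates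
    there.\<close>
  have "upper_end j \<in> closure A"
    unfolding closure_approachable
  proof (intro allI impI)
    fix e :: real assume "0 < e"
    then obtain q where q: "degree q \<le> j" "upper_end j - e < pos q"
      using less_upper_end_iff[of "upper_end j - e" j] by auto
    obtain p where p: "degree p \<le> j" "pos p < x"
      using j(1) lower_end_less_iff by blast
    obtain n where n: "pos q < shift (of_nat n * monom 1 j) x"
      using shift_multiple_passes[OF p(2,1) q(1)] by blast
    have "shift (of_nat n * monom 1 j) x < shift (of_nat n * monom 1 j) (upper_end j)"
      using j(2) by simp
    also have "\<dots> = upper_end j"
      by (intro shift_upper_end) (simp add: of_nat_poly degree_monom_eq)
    finally have "dist (shift (of_nat n * monom 1 j) x) (upper_end j) < e"
      using n q(2) by (simp add: dist_real_def)
    moreover have "shift (of_nat n * monom 1 j) x \<in> A"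
      using inv x by blast
    ultimately show "\<exists>y\<in>A. dist y (upper_end j) < e" by blast
  qed
  then have "upper_end j \<in> B"
    using \<open>closed A\<close> shift_upper_end_outside by (simp add: B_def)
  moreover have "closed B"
  proof -
    have "B = A \<inter> (\<Inter>v. shift v -` (- {lower_end j<..<upper_end j}))"
      by (auto simp: B_def)
    moreover have "closed (shift v -` (- {lower_end j<..<upper_end j}))" for v
      by (intro closed_vimage continuous_on_shift) auto
    ultimately show ?thesis
      using \<open>closed A\<close> by auto
  qed
  moreover have "invariant_set (range shift) B"
  proof -
    have stable: "shift w y \<in> B" if "y \<in> B" for w y
      using that inv by (auto simp: B_def shift_shift)
    have "y \<in> shift w ` B" if "y \<in> B" for w y
      using stable[OF that, of "- w"] by (intro image_eqI[of _ _ "shift (- w) y"]) (simp_all add: shift_shift shift_0)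
    then show ?thesis
      using stable by (auto simp: invariant_set_def)
  qed
  moreover have "B \<subseteq> A" by (auto simp: B_def)
  ultimately have "B = A"
    using min unfolding closed_minimal_set_def by blast
  then have "x \<in> B" using x by simp
  then have "shift 0 x \<notin> {lower_end j<..<upper_end j}"
    unfolding B_def by blast
  then show False using j by (simp add: shift_0)
qed

theorem theorem5p2:
  shows "\<exists>G :: (real \<Rightarrow> real) set.
    subgroup G (BijGroup UNIV) \<and>
    comm_group (transformation_group G) \<and>
    \<not> finitely_generated (transformation_group G) \<and>
    (\<forall>g\<in>G. orientation_preserving_C1_diffeo g) \<and>
    (\<exists>a b f. infinite_tower a b f \<and> (\<forall>j. f j \<in> G) \<and> (\<Union>j. {a j..b j}) = UNIV) \<and>
    \<not> (\<exists>M. radon_measure M \<and> emeasure M UNIV \<noteq> 0 \<and> invariant_measure G M) \<and>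
    \<not> (\<exists>A. closed_minimal_set G A)"
proof (intro exI conjI)
  show "subgroup (range shift) (BijGroup UNIV)" by (rule subgroup_shift)
  show "comm_group (transformation_group (range shift))" by (rule comm_group_shift)
  show "\<not> finitely_generated (transformation_group (range shift))" by (rule not_finitely_generated_shift)
  show "\<forall>g\<in>range shift. orientation_preserving_C1_diffeo g" using shift_C1_diffeo by blast
  show "infinite_tower lower_end upper_end (\<lambda>j. shift (monom 1 j))" by (rule infinite_tower_shift)
  show "\<forall>j. shift (monom 1 j) \<in> range shift" by blast
  have "x \<in> (\<Union>j. {lower_end j..upper_end j})" for x
    using inside_tower[of x] by (metis UN_I UNIV_I atLeastAtMost_iff less_imp_le)
  then show "(\<Union>j. {lower_end j..upper_end j}) = UNIV" by blast
  show "\<not> (\<exists>M. radon_measure M \<and> emeasure M UNIV \<noteq> 0 \<and> invariant_measure (range shift) M)"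
    using no_invariant_radon_measure by blast
  show "\<not> (\<exists>A. closed_minimal_set (range shift) A)"
    using no_closed_minimal_set by blast
qed


end
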